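(* Let $r\ge 1$ and $a>0$ be fixed and let $f_\star$ be $(p,\mathscr C)$-smooth on $[-a,a]^r$, with $p=\vartheta+s$, $\vartheta\in\mathbb N$, $0<s\le 1$. For $M\in\mathbb N$ put $h=2a/M$ and subdivide $[-a,a]^r$ into the $M^r$ cubes $C_{\mathbf x_{\mathbf i}}$, $\mathbf i\in[M]^r$, of side length $h$. Then, as $h\to 0$, there exists a collection $\mathbf B_\star=\{\boldsymbol\beta_{\star\mathbf i}\mid \mathbf i\in[M]^r\}$ of vectors $\boldsymbol\beta_{\star\mathbf i}\in\mathbb R^{r_\vartheta}$ such that $$\sup_{\mathbf x\in[-a,a]^r}\bigl| f_\star(\mathbf x)-\mathscr N(\mathbf x\mid \mathbf B_\star)\bigr| = O(h^p+2^{-m}),$$ where $\mathscr N(\mathbf x\mid\mathbf B_\star)=\sum_{\mathbf i\in[M]^r} I(\mathbf x\in C_{\mathbf x_{\mathbf i}})\,\mathbf N(\mathbf x\mid\mathbf x_{\mathbf i})^\top\boldsymbol\beta_{\star\mathbf i}$.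
   Context: Notation: $[n]=\{1,\dots,n\}$, $\mathbb N_0=\{0\}\cup\mathbb N$, $\mathbf 1_n$ is the $n$-vector of ones, $I(\cdot)$ is the indicator, $\|\boldsymbol\alpha\|_1=\sum_i|\alpha_i|$, $f^{(\boldsymbol\alpha)}$ is the partial derivative with multi-index $\boldsymbol\alpha$. Smoothness. For $p=\vartheta+s$ with $\vartheta\in\mathbb N$, $0<s\le1$, a function $f:\mathbb U\subseteq\mathbb R^r\to\mathbb R$ is $(p,\mathscr C)$-smooth if for every $\boldsymbol\alpha\in\mathbb N_0^r$ with $\|\boldsymbol\alpha\|_1=\vartheta$ the partial derivative $f^{(\boldsymbol\alpha)}$ exists and $|f^{(\boldsymbol\alpha)}(\mathbf x)-f^{(\boldsymbol\alpha)}(\mathbf z)|\le\mathscr C\|\mathbf x-\mathbf z\|^s$ for all $\mathbf x,\mathbf z\in\mathbb U$; $\mathscr C$ is a constant. Product network. $\sigma(x)=\max(x,0)$; for $\mathbf u,\mathbf v\in\mathbb R^n$, $\boldsymbol\sigma_{\mathbf v}(\mathbf u)=(\sigma(u_1-v_1),\dots,\sigma(u_n-v_n))^\top$. For $m\in\mathbb N$ and scalars $x,y$ let $P_m(x,y)=\mathbf w_{m+3}\boldsymbol\sigma_{\mathbf v_{m+3}}\bigl(\mathbf w_{m+2}\boldsymbol\sigma_{\mathbf v_{m+2}}(\cdots\mathbf w_1\boldsymbol\sigma_{\mathbf v_1}(\boldsymbol\ell^m_{x,y})\cdots)\bigr)$, where $\boldsymbol\ell^m_{x,y}=\frac12\bigl(\frac{x-y+1}{2},\,x-y+1,\,x+y+2^{-m},\,\frac{x+y}{2},\,x+y,\,\frac12\bigr)^\top$;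 $\mathbf v_k=\mathbf 1_2\otimes(0,2^{1-2k},0)^\top$ for $k\in[m+1]$, $\mathbf v_{m+2}=\mathbf v_{m+3}=-1$; $\mathbf w_k=\mathbf I_2\otimes\widetilde{\mathbf w}$ for $k\in[m]$, $\mathbf w_{m+1}=(-1,1,-1,1,-1,1)$, $\mathbf w_{m+2}=-1$, $\mathbf w_{m+3}=1$; $\widetilde{\mathbf w}=\begin{pmatrix}1/2&-1/2&0\\1&-1&0\\1&-1&1\end{pmatrix}$. Hierarchical network. For $\mathbf u\in\mathbb R^{2^q}$, $q\in\mathbb N$: Step 1 computes $P_m(u_1,u_2),P_m(u_3,u_4),\dots,P_m(u_{2^q-1},u_{2^q})$; Step $n$ ($2\le n\le q$) applies $P_m$ to consecutive pairs of the outputs of Step $n-1$. The single scalar left after $q$ steps is denoted $\mathcal H_m(\mathbf u)$. For $\mathbf x\in\mathbb R^r$, $\boldsymbol\alpha\in\mathbb N_0^r$, let $\boldsymbol\ell_{\mathbf x\mid\boldsymbol\alpha}=(x_1^{\alpha_1},\dots,x_r^{\alpha_r},\mathbf 1_q^\top)^\top$ with $q=2^{\lceil\log_2 r\rceil}-r$ if $r\ge2$ and $q=1$ if $r=1$ (with $0^0=1$). Basis. $r_\vartheta=\binom{r+\vartheta}{r}$ and $\boldsymbol\alpha_1,\dots,\boldsymbol\alpha_{r_\vartheta}$ enumerate the multi-indices in $\mathbb N_0^r$ with $\|\boldsymbol\alpha\|_1\le\vartheta$. Put $\mathbf N(\mathbf x\mid\mathbf x_0)=\bigl(\mathcal H_m(\boldsymbol\ell_{\mathbf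 x-\mathbf x_0\mid\boldsymbol\alpha_1}),\dots,\mathcal H_m(\boldsymbol\ell_{\mathbf x-\mathbf x_0\mid\boldsymbol\alpha_{r_\vartheta}})\bigr)^\top$. Cubes. $\mathbf x_{\mathbf i}$ is the bottom-left corner of the cube with index $\mathbf i$, and $C_{\mathbf x_{\mathbf i}}=\{\mathbf x\mid\mathbf x-\mathbf x_{\mathbf i}\in[0,h]^r\}$, with the convention that points lying on faces shared by several cubes are assigned to exactly one of them, so that the sets $C_{\mathbf x_{\mathbf i}}$ are pairwise disjoint with union $[-a,a]^r$. *)

theory Defs
  imports "HOL-Analysis.Analysis"
begin

text \<open>Dimension \<open>r\<close> is \<open>CARD('n)\<close>; the linear order on \<open>'n\<close> fixes which coordinate is the first,
  the second, and so on. Multi-indices are elements of \<open>nat ^ 'n\<close>.\<close>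

definition mi_norm :: "nat ^ 'n \<Rightarrow> nat" where
  "mi_norm \<gamma> = (\<Sum>j\<in>UNIV. \<gamma> $ j)"


section \<open>Smoothness\<close>

text \<open>The difference quotient only involves points of \<open>U\<close>, so at a boundary point of a box this is
  the one-sided derivative, as appropriate for a function that is defined on \<open>U\<close> only.\<close>

definition has_partial_on :: "(real ^ 'n) set \<Rightarrow> 'n \<Rightarrow> (real ^ 'n \<Rightarrow> real) \<Rightarrow> (real ^ 'n \<Rightarrow> real) \<Rightarrow> bool"
  where
  "has_partial_on U j f g \<longleftrightarrow>
     (\<forall>x\<in>U. ((\<lambda>t. f (x + t *\<^sub>R axis j 1)) has_real_derivative g x)
              (at 0 within {t. x + t *\<^sub>R axis j 1 \<in> U}))"

fun has_iter_partial_on ::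
  "(real ^ 'n) set \<Rightarrow> 'n list \<Rightarrow> (real ^ 'n \<Rightarrow> real) \<Rightarrow> (real ^ 'n \<Rightarrow> real) \<Rightarrow> bool" where
  "has_iter_partial_on U [] f g \<longleftrightarrow> (\<forall>x\<in>U. g x = f x)"
| "has_iter_partial_on U (j # js) f g \<longleftrightarrow>
     (\<exists>h. has_iter_partial_on U js f h \<and> has_partial_on U j h g)"

text \<open>\<open>g\<close> is the partial derivative of \<open>f\<close> on \<open>U\<close> with multi-index \<open>\<gamma>\<close>, read as
  the iterated derivative in which the last coordinate is differentiated first:
  first \<open>\<gamma>\<^sub>r\<close> times in coordinate \<open>r\<close>, and finally \<open>\<gamma>\<^sub>1\<close> times in coordinate \<open>1\<close>.\<close>

definition has_mi_partial_on ::
  "(real ^ 'n::{finite,linorder}) set \<Rightarrow> nat ^ 'n::{finite,linorder} \<Rightarrow>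
   (real ^ 'n::{finite,linorder} \<Rightarrow> real) \<Rightarrow> (real ^ 'n::{finite,linorder} \<Rightarrow> real) \<Rightarrow> bool"
  where
  "has_mi_partial_on U \<gamma> f g \<longleftrightarrow>
     has_iter_partial_on U
       (concat (map (\<lambda>j. replicate (\<gamma> $ j) j) (sorted_list_of_set UNIV))) f g"

text \<open>\<open>(p, C)\<close>-smoothness on \<open>U\<close> for \<open>p = \<theta> + s\<close>.\<close>

definition pC_smooth_on ::
  "nat \<Rightarrow> real \<Rightarrow> real \<Rightarrow> (real ^ 'n::{finite,linorder}) set \<Rightarrow>
   (real ^ 'n::{finite,linorder} \<Rightarrow> real) \<Rightarrow> bool" where
  "pC_smooth_on \<theta> s C U f \<longleftrightarrow>
     (\<forall>\<gamma>. mi_norm \<gamma> = \<theta> \<longrightarrow>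
        (\<exists>g. has_mi_partial_on U \<gamma> f g \<and>
             (\<forall>x\<in>U. \<forall>z\<in>U. \<bar>g x - g z\<bar> \<le> C * norm (x - z) powr s)))"


section \<open>The product network\<close>

definition relu :: "real \<Rightarrow> real" where
  "relu x = max x 0"

definition relu_shift :: "real ^ 'k \<Rightarrow> real ^ 'k \<Rightarrow> real ^ 'k" where
  "relu_shift v u = (\<chi> j. relu (u $ j - v $ j))"

definition prod_input :: "nat \<Rightarrow> real \<Rightarrow> real \<Rightarrow> real ^ 6" where
  "prod_input m x y =
     (1/2) *\<^sub>R vector [(x - y + 1) / 2, x - y + 1, x + y + 2 powi (- int m), (x + y) / 2, x + y, 1/2]"

definition prod_shift :: "nat \<Rightarrow> real ^ 6" where
  "prod_shift k = vector [0, 2 powi (1 - 2 * int k), 0, 0, 2 powi (1 - 2 * int k), 0]"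

text \<open>The Kronecker product of the \<open>2 \<times> 2\<close> identity with the \<open>3 \<times> 3\<close> weight matrix.\<close>

definition prod_weight :: "real ^ 6 ^ 6" where
  "prod_weight = vector
     [vector [1/2, -1/2, 0,   0,    0, 0],
      vector [  1,   -1, 0,   0,    0, 0],
      vector [  1,   -1, 1,   0,    0, 0],
      vector [  0,    0, 0, 1/2, -1/2, 0],
      vector [  0,    0, 0,   1,   -1, 0],
      vector [  0,    0, 0,   1,   -1, 1]]"

fun prod_hidden :: "nat \<Rightarrow> real ^ 6 \<Rightarrow> real ^ 6" where
  "prod_hidden 0 u = u"
| "prod_hidden (Suc k) u = prod_weight *v relu_shift (prod_shift (Suc k)) (prod_hidden k u)"

text \<open>From layer \<open>m + 1\<close> on the output is scalar, and the last two layers have weights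
  \<open>-1\<close>, \<open>1\<close> and shift \<open>-1\<close> each.\<close>

definition prod_net :: "nat \<Rightarrow> real \<Rightarrow> real \<Rightarrow> real" where
  "prod_net m x y =
     (let z1 = vector [-1, 1, -1, 1, -1, 1] \<bullet>
                 relu_shift (prod_shift (m + 1)) (prod_hidden m (prod_input m x y));
          z2 = - 1 * relu (z1 - (- 1));
          z3 = 1 * relu (z2 - (- 1))
      in z3)"


section \<open>The hierarchical network\<close>

fun hier_step :: "nat \<Rightarrow> real list \<Rightarrow> real list" where
  "hier_step m (x # y # us) = prod_net m x y # hier_step m us"
| "hier_step m us = us"

text \<open>Only meant for lists whose length is a power of two; then \<open>log 2 (length u)\<close> is the number of
  steps and a single number is left.\<close>

definition hier_net :: "nat \<Rightarrow> real list \<Rightarrow> real" where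
  "hier_net m u = hd ((hier_step m ^^ nat \<lfloor>log 2 (real (length u))\<rfloor>) u)"

definition pad_length :: "nat \<Rightarrow> nat" where
  "pad_length r = (if r = 1 then 1 else 2 ^ nat \<lceil>log 2 (real r)\<rceil> - r)"

definition mono_input :: "real ^ 'n::{finite,linorder} \<Rightarrow> nat ^ 'n::{finite,linorder} \<Rightarrow> real list" where
  "mono_input x \<gamma> =
     map (\<lambda>j. (x $ j) ^ (\<gamma> $ j)) (sorted_list_of_set UNIV) @ replicate (pad_length CARD('n)) 1"


section \<open>Cubes\<close>

definition cube_indices :: "nat \<Rightarrow> (nat ^ 'n) set" where
  "cube_indices M = {i. \<forall>j. i $ j \<in> {1..M}}"

definition big_cube :: "real \<Rightarrow> (real ^ 'n) set" where
  "big_cube a = cbox (\<chi> j. - a) (\<chi> j. a)"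

definition side :: "real \<Rightarrow> nat \<Rightarrow> real" where
  "side a M = 2 * a / real M"

definition corner :: "real \<Rightarrow> nat \<Rightarrow> nat ^ 'n \<Rightarrow> real ^ 'n" where
  "corner a M i = (\<chi> j. - a + (real (i $ j) - 1) * side a M)"

text \<open>\<open>Q\<close> assigns to every index its cube, where each point on shared faces has been given to exactly
  one of the adjacent closed cubes. How this is done is left open.\<close>

definition cube_partition :: "real \<Rightarrow> nat \<Rightarrow> (nat ^ 'n \<Rightarrow> (real ^ 'n) set) \<Rightarrow> bool" where
  "cube_partition a M Q \<longleftrightarrow>
     (\<forall>i\<in>cube_indices M. Q i \<subseteq> {x. x - corner a M i \<in> cbox 0 (\<chi> j. side a M)}) \<and>
     disjoint_family_on Q (cube_indices M) \<and>
     (\<Union>i\<in>cube_indices M. Q i) = big_cube a"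


section \<open>The localized network\<close>

text \<open>\<open>mi\<close> enumerates the multi-indices of norm at most \<open>\<theta>\<close> by \<open>1, \<dots>, R\<close>, where \<open>R\<close> is their number.
  The vector attached to cube \<open>i\<close> is \<open>(B i 1, \<dots>, B i R)\<close>; other values of \<open>B\<close> are irrelevant.\<close>

definition num_basis :: "nat \<Rightarrow> nat \<Rightarrow> nat" where
  "num_basis r \<theta> = (r + \<theta>) choose r"

definition local_net ::
  "nat \<Rightarrow> real \<Rightarrow> nat \<Rightarrow> nat \<Rightarrow> (nat \<Rightarrow> nat ^ 'n::{finite,linorder}) \<Rightarrow>
   (nat ^ 'n::{finite,linorder} \<Rightarrow> (real ^ 'n::{finite,linorder}) set) \<Rightarrow>
   (nat ^ 'n::{finite,linorder} \<Rightarrow> nat \<Rightarrow> real) \<Rightarrow> real ^ 'n::{finite,linorder} \<Rightarrow> real" where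
  "local_net \<theta> a M m mi Q B x =
     (\<Sum>i\<in>cube_indices M. indicat_real (Q i) x *
        (\<Sum>k=1..num_basis CARD('n) \<theta>. hier_net m (mono_input (x - corner a M i) (mi k)) * B i k))"

end

theory Submission
  imports Defs
begin

text \<open>On each cube \<open>f\<close> is replaced by a Taylor polynomial at the corner, and each monomial by the
  hierarchical network, which is accurate up to \<open>O(2\<^sup>-\<^sup>m)\<close> on \<open>[0, 1]\<close>. Since only the partial
  derivatives in the prescribed order are known to exist, the expansion is done one coordinate at a
  time, starting with the coordinate that is differentiated first; this never interchanges two
  derivatives. For the network error the Taylor coefficients must be bounded
  uniformly in the corner. The expansion at a single point shows that \<open>f\<close> is bounded; the lower
  order derivatives are then bounded by interpolation between a function and its highest derivative.\<close>

section \<open>Accuracy of the networks\<close>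

text \<open>Hoelder control is given only for derivatives of order exactly \<open>\<theta>\<close>.
  A lower derivative is merely known to exist as an intermediate stage of such a chain; neither its
  continuity nor a total derivative is assumed. Every analytic step therefore runs along a line
  parallel to an axis, where one-variable Taylor and mean value arguments are legitimate,
  one-sidedly at the boundary too. Derivatives are indexed by sorted lists whose head is
  differentiated last, and prepending a coordinate no larger than the head keeps a list sorted; so
  the largest coordinate is expanded first and the recursion goes to smaller ones. A circularity has
  to be avoided: the coefficients must be bounded before the expansion is useful, yet the bound on
  \<open>f\<close> itself comes from the expansion. The way out is that the remainder constant
  depends neither on the centre nor on the size of the coefficients, so it is available before any
  uniform bound on them.\<close>

lemma exhaust_6:
  fixes x :: 6
  shows "x = 1 \<or> x = 2 \<or> x = 3 \<or> x = 4 \<or> x = 5 \<or> x = 6"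
proof (induct x)
  case (of_int z)
  then have "z = 0 \<or> z = 1 \<or> z = 2 \<or> z = 3 \<or> z = 4 \<or> z = 5" by fastforce
  then show ?case by auto
qed

lemma forall_6: "(\<forall>i::6. P i) \<longleftrightarrow> P 1 \<and> P 2 \<and> P 3 \<and> P 4 \<and> P 5 \<and> P 6"
  by (metis exhaust_6)

lemma sum_6: "sum f (UNIV::6 set) = f 1 + f 2 + f 3 + f 4 + f 5 + f 6"
proof -
  have U: "UNIV = {1, 2, 3, 4, 5, 6::6}"
    using exhaust_6 by auto
  show ?thesis
    unfolding U by (simp add: ac_simps)
qed

lemma vector_6 [simp]:
  "(vector [u,v,w,x,y,z] :: 'a::zero ^ 6) $ 1 = u"
  "(vector [u,v,w,x,y,z] :: 'a::zero ^ 6) $ 2 = v"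
  "(vector [u,v,w,x,y,z] :: 'a::zero ^ 6) $ 3 = w"
  "(vector [u,v,w,x,y,z] :: 'a::zero ^ 6) $ 4 = x"
  "(vector [u,v,w,x,y,z] :: 'a::zero ^ 6) $ 5 = y"
  "(vector [u,v,w,x,y,z] :: 'a::zero ^ 6) $ 6 = z"
  unfolding vector_def by simp_all

text \<open>The two halves of the network run the sawtooth iteration on \<open>u = (x - y + 1) / 2\<close> and
  \<open>v = (x + y) / 2\<close>. Its partial sums converge to \<open>u (1 - u)\<close> and \<open>v (1 - v)\<close>, and
  \<open>x y = u (1 - u) - v (1 - v) + (x + y) / 2 - 1 / 4\<close>.\<close>

fun saw :: "nat \<Rightarrow> real \<Rightarrow> real" where
  "saw 0 u = u"
| "saw (Suc k) u = relu (saw k u / 2) - relu (saw k u - (1/4) ^ k / 2)"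

text \<open>Layer \<open>Suc k\<close> shifts by half of \<open>(1/4) ^ k\<close>, the upper bound
  of \<open>saw k\<close>, so the kink of the next sawtooth sits in the middle of the range.\<close>

lemma prod_shift_Suc:
  "prod_shift (Suc k) = vector [0, (1/4) ^ k / 2, 0, 0, (1/4) ^ k / 2, 0]"
proof -
  have "1 - 2 * int (Suc k) = - int (2 * k + 1)" by simp
  then have "(2::real) powi (1 - 2 * int (Suc k)) = inverse (2 ^ (2 * k + 1))"
    by (simp only: power_int_minus power_int_of_nat)
  also have "\<dots> = (1/4) ^ k / 2"
    by (simp add: power_mult power_one_over inverse_eq_divide)
  finally show ?thesis
    by (simp only: prod_shift_def)
qed

text \<open>\<open>saw k\<close> is the \<open>k\<close>-fold iterate of the tent map of height 1,
  divided by \<open>4 ^ k\<close>.\<close>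

lemma saw_bounds:
  assumes "0 \<le> u" "u \<le> 1"
  shows "0 \<le> saw k u" "saw k u \<le> (1/4) ^ k"
proof -
  have "0 \<le> saw k u \<and> saw k u \<le> (1/4) ^ k"
    by (induction k) (use assms in \<open>auto simp: relu_def max_def\<close>)
  then show "0 \<le> saw k u" "saw k u \<le> (1/4) ^ k" by auto
qed

text \<open>With \<open>c = 4 ^ k\<close> and \<open>d = (1/4) ^ k\<close>, the parabola
  \<open>y * (1 - c * y)\<close> is symmetric under \<open>y\<close> to \<open>d - y\<close>, so
  both branches of the tent give the same value. The right side is
  \<open>t + t * (1 - 4 * c * t)\<close>: one summand split off, plus the parabola of the next
  level.\<close>

lemma tent_identity:
  fixes c d t y :: real
  assumes "c * d = 1" "t = y / 2 \<or> t = (d - y) / 2"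
  shows "y * (1 - c * y) = 2 * t - 4 * c * t\<^sup>2"
proof -
  have "y = 2 * t \<or> y = d - 2 * t" using assms(2) by auto
  then consider "y = 2 * t" | "y = d - 2 * t" by blast
  then show ?thesis
  proof cases
    case 1
    then show ?thesis by (simp add: algebra_simps power2_eq_square)
  next
    case y: 2
    have "y * (1 - c * y) = 2 * (c * d) * t - 4 * c * t\<^sup>2 + (1 - c * d) * (d - 2 * t)"
      by (simp add: y algebra_simps power2_eq_square)
    then show ?thesis by (simp add: assms(1))
  qed
qed

text \<open>Telescoping by \<open>tent_identity\<close>. In terms of
  \<open>z = 4 ^ k * saw k u\<close>, which lies in [0, 1], the remainder is
  \<open>(1/4) ^ k * z * (1 - z)\<close>; its sign and size are then evident.\<close>

lemma sum_saw:
  assumes "0 \<le> u" "u \<le> 1"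
  shows "u * (1 - u) - (\<Sum>i=1..k. saw i u) = saw k u * (1 - 4 ^ k * saw k u)"
proof (induction k)
  case (Suc k)
  have "0 \<le> saw k u" "saw k u \<le> (1/4) ^ k" using saw_bounds [OF assms] by auto
  then have "saw (Suc k) u = saw k u / 2 \<or> saw (Suc k) u = ((1/4) ^ k - saw k u) / 2"
    by (auto simp: relu_def max_def)
  moreover have "4 ^ k * (1/4::real) ^ k = 1" by (simp flip: power_mult_distrib)
  ultimately have "saw k u * (1 - 4 ^ k * saw k u) = 2 * saw (Suc k) u - 4 * 4 ^ k * (saw (Suc k) u)\<^sup>2"
    by (intro tent_identity)
  then show ?case using Suc.IH by (simp add: algebra_simps power2_eq_square del: saw.simps)
qed simp

lemma sum_saw_error:
  assumes "0 \<le> u" "u \<le> 1"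
  shows "0 \<le> u * (1 - u) - (\<Sum>i=1..k. saw i u)" "u * (1 - u) - (\<Sum>i=1..k. saw i u) \<le> (1/4) ^ k"
proof -
  note y = saw_bounds [OF assms, of k]
  have "4 ^ k * saw k u \<le> 4 ^ k * (1/4) ^ k" using y by (intro mult_left_mono) auto
  then have z: "4 ^ k * saw k u \<le> 1" by (simp flip: power_mult_distrib)
  show "0 \<le> u * (1 - u) - (\<Sum>i=1..k. saw i u)"
    unfolding sum_saw [OF assms] using y z by simp
  have "saw k u * (1 - 4 ^ k * saw k u) \<le> saw k u * 1" 
    using y z by (intro mult_left_mono) auto
  then show "u * (1 - u) - (\<Sum>i=1..k. saw i u) \<le> (1/4) ^ k"
    unfolding sum_saw [OF assms] using y by simp
qed

lemma relu_nonneg: "0 \<le> x \<Longrightarrow> relu x = x"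
  by (simp add: relu_def)

text \<open>Slots 2 and 5 carry the current sawtooth values and slots 1 and 4 their halves, so one
  layer can form both relu terms of the next value. Slots 3 and 6 accumulate the partial sums; being
  nonnegative, they pass the relu unchanged.\<close>

lemma hidden_layer:
  fixes k :: nat and p q u v :: real
  assumes "0 \<le> p" "0 \<le> q"
  defines "t \<equiv> \<lambda>u::real. relu (u / 2) - relu (u - (1/4) ^ k / 2)"
  shows "prod_weight *v relu_shift (prod_shift (Suc k)) (vector [u/2, u, p, v/2, v, q]) =
    vector [t u / 2, t u, p + t u, t v / 2, t v, q + t v]"
    and "vector [-1, 1, -1, 1, -1, 1] \<bullet>
      relu_shift (prod_shift (Suc k)) (vector [u/2, u, p, v/2, v, q]) = (q + t v) - (p + t u)"
proof -
  have "relu_shift (prod_shift (Suc k)) (vector [u/2, u, p, v/2, v, q]) =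
      vector [relu (u/2), relu (u - (1/4) ^ k / 2), p, relu (v/2), relu (v - (1/4) ^ k / 2), q]"
    using assms(1,2) by (simp add: relu_shift_def prod_shift_Suc vec_eq_iff forall_6 relu_nonneg)
  then show "prod_weight *v relu_shift (prod_shift (Suc k)) (vector [u/2, u, p, v/2, v, q]) =
        vector [t u / 2, t u, p + t u, t v / 2, t v, q + t v]"
    and "vector [-1, 1, -1, 1, -1, 1] \<bullet>
      relu_shift (prod_shift (Suc k)) (vector [u/2, u, p, v/2, v, q]) = (q + t v) - (p + t u)"
    by (simp_all add: vec_eq_iff forall_6 matrix_vector_mult_def inner_vec_def sum_6
        prod_weight_def t_def diff_divide_distrib)
qed

lemma prod_hidden_eq:
  assumes "0 \<le> u" "u \<le> 1" "0 \<le> v" "v \<le> 1" "0 \<le> p" "0 \<le> q"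
  shows "prod_hidden k (vector [u/2, u, p, v/2, v, q]) =
    vector [saw k u / 2, saw k u, p + (\<Sum>i=1..k. saw i u), saw k v / 2, saw k v, q + (\<Sum>i=1..k. saw i v)]"
proof (induction k)
  case (Suc k)
  have "0 \<le> p + (\<Sum>i=1..k. saw i u)" "0 \<le> q + (\<Sum>i=1..k. saw i v)"
    using saw_bounds assms by (auto intro!: sum_nonneg add_nonneg_nonneg)
  then show ?case
    by (simp add: Suc.IH hidden_layer add.assoc)
qed simp

text \<open>\<open>relu (1 - relu (1 - w))\<close> truncates \<open>w\<close> to [0, 1]: this is the
  purpose of the last two layers, and it makes an output admissible as an input of the next
  step.\<close>

lemma prod_net_eq:
  fixes x y :: real and m :: nat
  assumes "0 \<le> x" "x \<le> 1" "0 \<le> y" "y \<le> 1"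
  defines "u \<equiv> (x - y + 1) / 2" and "v \<equiv> (x + y) / 2"
  defines "w \<equiv> (x + y) / 2 + 2 powi (- int m) / 2 - 1/4
    + (\<Sum>i=1..m+1. saw i u) - (\<Sum>i=1..m+1. saw i v)"
  shows "prod_net m x y = relu (1 - relu (1 - w))"
proof -
  have uv: "0 \<le> u" "u \<le> 1" "0 \<le> v" "v \<le> 1" using assms by auto
  define p where "p = (x + y + 2 powi (- int m)) / 2"
  have p: "0 \<le> p" using assms by (simp add: p_def)
  have inp: "prod_input m x y = vector [u/2, u, p, v/2, v, 1/4]"
    by (simp add: prod_input_def u_def v_def p_def vec_eq_iff forall_6)
  have "0 \<le> p + (\<Sum>i=1..m. saw i u)" "0 \<le> 1/4 + (\<Sum>i=1..m. saw i v)"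
    using saw_bounds uv p by (auto intro!: sum_nonneg add_nonneg_nonneg)
  then have "vector [-1, 1, -1, 1, -1, 1] \<bullet>
      relu_shift (prod_shift (m + 1)) (prod_hidden m (prod_input m x y)) = - w"
    using uv p
    by (simp add: inp prod_hidden_eq hidden_layer w_def p_def add_divide_distrib)
  then show ?thesis
    unfolding prod_net_def Let_def by simp
qed

lemma prod_net_approx:
  assumes "0 \<le> x" "x \<le> 1" "0 \<le> y" "y \<le> 1"
  shows "0 \<le> prod_net m x y" "prod_net m x y \<le> 1" "\<bar>prod_net m x y - x * y\<bar> \<le> 2 powi (- int m)"
proof -
  show "0 \<le> prod_net m x y" "prod_net m x y \<le> 1"
    unfolding prod_net_eq [OF assms] by (auto simp: relu_def)
  define u v where "u = (x - y + 1) / 2" and "v = (x + y) / 2"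
  have u: "0 \<le> u" "u \<le> 1" and v: "0 \<le> v" "v \<le> 1" using assms by (auto simp: u_def v_def)
  define w where "w = (x + y) / 2 + 2 powi (- int m) / 2 - 1/4
    + (\<Sum>i=1..m+1. saw i u) - (\<Sum>i=1..m+1. saw i v)"
  have xy: "x * y = (x + y) / 2 - 1/4 + u * (1 - u) - v * (1 - v)"
    by (simp add: u_def v_def field_simps)
  \<comment> \<open>Each sawtooth sum falls short of its parabola by at most
    \<open>(1/4) ^ (m+1)\<close>, hence by at most half of 2^-m. The offset of half of 2^-m in
    \<open>w\<close> therefore places \<open>w - x * y\<close> between 0 and 2^-m.\<close>
  have "(1/4::real) ^ (m+1) \<le> (1/2) ^ m / 2"
    using power_mono [of "1/4::real" "1/2" "m+1"] by simp
  also have "(1/2::real) ^ m = 2 powi (- int m)"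
    by (simp add: power_int_minus power_one_over inverse_eq_divide)
  finally have "\<bar>w - x * y\<bar> \<le> 2 powi (- int m)"
    using sum_saw_error [OF u, of "m+1"] sum_saw_error [OF v, of "m+1"]
    unfolding w_def xy by linarith
  \<comment> \<open>As the target lies in [0, 1], truncating \<open>w\<close> to that interval
    cannot increase the distance to it.\<close>
  moreover have "0 \<le> x * y" "x * y \<le> 1" using assms by (auto simp: mult_le_one)
  moreover have "prod_net m x y = relu (1 - relu (1 - w))"
    unfolding w_def u_def v_def by (rule prod_net_eq [OF assms])
  ultimately show "\<bar>prod_net m x y - x * y\<bar> \<le> 2 powi (- int m)"
    by (auto simp: relu_def)
qed

text \<open>Comparing products of whole lists lets errors add up: all factors stay in [0, 1], so
  each of the \<open>n\<close> pairs contributes at most the error of a single product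
  network.\<close>

lemma hier_step_approx:
  assumes "set us \<subseteq> {0..1}" "length us = 2 * n"
  shows "length (hier_step m us) = n \<and> set (hier_step m us) \<subseteq> {0..1} \<and>
    \<bar>prod_list (hier_step m us) - prod_list us\<bar> \<le> real n * 2 powi (- int m)"
  using assms
proof (induction m us arbitrary: n rule: hier_step.induct)
  case (1 m x y us)
  define e :: real where "e = 2 powi (- int m)"
  obtain k where n: "n = Suc k" using 1(3) by (cases n) auto
  let ?P = "prod_net m x y" and ?L = "prod_list (hier_step m us)" and ?l = "prod_list us"
  have xy: "0 \<le> x" "x \<le> 1" "0 \<le> y" "y \<le> 1" using 1(2) by auto
  note P = prod_net_approx [OF xy, of m, folded e_def]
  have IH: "length (hier_step m us) = k" "set (hier_step m us) \<subseteq> {0..1}" "\<bar>?L - ?l\<bar> \<le> real k * e"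
    using 1 n by (auto simp: e_def)
  have unit: "0 \<le> prod_list zs \<and> prod_list zs \<le> 1" if "set zs \<subseteq> {0..1}" for zs :: "real list"
    using that by (induction zs) (auto simp: mult_le_one)
  have "\<bar>?P * ?L - x * y * ?l\<bar> = \<bar>?P * (?L - ?l) + (?P - x * y) * ?l\<bar>"
    by (simp add: algebra_simps)
  also have "\<dots> \<le> \<bar>?P\<bar> * \<bar>?L - ?l\<bar> + \<bar>?P - x * y\<bar> * \<bar>?l\<bar>"
    by (metis abs_mult abs_triangle_ineq)
  also have "\<dots> \<le> 1 * (real k * e) + e * 1"
    using P IH unit [of us] 1(2) by (intro add_mono mult_mono) auto
  finally show ?case
    using P IH by (auto simp: n e_def algebra_simps)
qed auto

text \<open>\<open>2 ^ q - 1\<close> is the number of product networks in a binary tree with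
  \<open>2 ^ q\<close> leaves.\<close>

lemma hier_iter_approx:
  assumes "set us \<subseteq> {0..1}" "length us = 2 ^ q"
  shows "\<bar>hd ((hier_step m ^^ q) us) - prod_list us\<bar> \<le> (2 ^ q - 1) * 2 powi (- int m)"
  using assms
proof (induction q arbitrary: us)
  case 0
  then show ?case by (cases us) auto
next
  case (Suc q)
  have s: "length (hier_step m us) = 2 ^ q" "set (hier_step m us) \<subseteq> {0..1}"
    "\<bar>prod_list (hier_step m us) - prod_list us\<bar> \<le> 2 ^ q * 2 powi (- int m)"
    using hier_step_approx [of us "2 ^ q" m] Suc.prems by auto
  have "\<bar>hd ((hier_step m ^^ q) (hier_step m us)) - prod_list (hier_step m us)\<bar>
      \<le> (2 ^ q - 1) * 2 powi (- int m)"
    using Suc.IH s by blast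
  then show ?case using s by (simp add: funpow_Suc_right algebra_simps del: funpow.simps)
qed

lemma hier_net_approx:
  assumes "set us \<subseteq> {0..1}" "length us = 2 ^ q"
  shows "\<bar>hier_net m us - prod_list us\<bar> \<le> 2 ^ q * 2 powi (- int m)"
proof -
  have "log 2 (real (length us)) = real q"
    using assms by (simp add: log_nat_power)
  then have "\<bar>hier_net m us - prod_list us\<bar> \<le> (2 ^ q - 1) * 2 powi (- int m)"
    using hier_iter_approx [OF assms] by (simp add: hier_net_def)
  also have "\<dots> \<le> 2 ^ q * 2 powi (- int m)" by (intro mult_right_mono) auto
  finally show ?thesis .
qed

lemma length_mono_input:
  "\<exists>q. \<forall>(x :: real ^ 'n::{finite,linorder}) \<gamma>. length (mono_input x \<gamma>) = 2 ^ q"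
proof (cases "CARD('n) = 1")
  case True
  then show ?thesis by (intro exI [of _ 1]) (simp add: mono_input_def pad_length_def)
next
  case False
  have r: "real CARD('n) \<ge> 1" using zero_less_card_finite [where 'a='n] by linarith
  define q where "q = nat \<lceil>log 2 (real CARD('n))\<rceil>"
  have "log 2 (real CARD('n)) \<le> real q"
    unfolding q_def by (rule real_nat_ceiling_ge)
  then have "real CARD('n) \<le> 2 powr real q"
    using r by (simp add: log_le_iff)
  then have "CARD('n) \<le> 2 ^ q"
    by (simp add: powr_realpow)
  then show ?thesis
    using False by (intro exI [of _ q]) (simp add: mono_input_def pad_length_def q_def)
qed

lemma prod_list_mono_input: "prod_list (mono_input x \<gamma>) = (\<Prod>j\<in>UNIV. (x $ j) ^ (\<gamma> $ j))"
  by (simp add: mono_input_def flip: prod.distinct_set_conv_list)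

section \<open>One-dimensional estimates and partial derivatives\<close>

text \<open>Polymorphic in the entries, because it both moves a point along a coordinate line and
  clears one exponent of a multi-index.\<close>

definition upd :: "'b ^ 'n \<Rightarrow> 'n \<Rightarrow> 'b \<Rightarrow> 'b ^ 'n" where
  "upd x j t = (\<chi> i. if i = j then t else x $ i)"

lemma upd_nth: "upd x j t $ i = (if i = j then t else x $ i)"
  by (simp add: upd_def)

lemma upd_same [simp]: "upd x j t $ j = t"
  by (simp add: upd_def)

lemma upd_triv [simp]: "upd x j (x $ j) = x"
  by (simp add: upd_def vec_eq_iff)

lemma upd_upd [simp]: "upd (upd x j t) j u = upd x j u"
  by (simp add: upd_def vec_eq_iff)

lemma norm_diff_upd:
  fixes x :: "real ^ 'n"
  shows "norm (upd x j t - upd x j u) = \<bar>t - u\<bar>"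
proof -
  have "upd x j t - upd x j u = (t - u) *\<^sub>R axis j 1"
    by (auto simp: vec_eq_iff upd_nth axis_def)
  then show ?thesis by simp
qed

lemma mem_big_cube: "x \<in> big_cube a \<longleftrightarrow> (\<forall>j. x $ j \<in> {-a..a})"
  by (auto simp: big_cube_def mem_box_cart)

lemma upd_mem_big_cube: "x \<in> big_cube a \<Longrightarrow> t \<in> {-a..a} \<Longrightarrow> upd x j t \<in> big_cube a"
  by (simp add: mem_big_cube upd_nth)

lemma has_partial_on_line:
  assumes "has_partial_on (big_cube a) j g g'" "x \<in> big_cube a" "t \<in> {-a..a}"
  shows "((\<lambda>t. g (upd x j t)) has_real_derivative g' (upd x j t)) (at t within {-a..a})"
proof -
  have [simp]: "upd x j t + \<tau> *\<^sub>R axis j 1 = upd x j (t + \<tau>)" for \<tau>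
    by (auto simp: vec_eq_iff upd_nth axis_def)
  have mem: "upd x j u \<in> big_cube a \<longleftrightarrow> u \<in> {-a..a}" for u
    using assms(2) by (auto simp: mem_big_cube upd_nth)
  have "{\<tau>. t + \<tau> \<in> {-a..a}} = {-a - t..a - t}"
    by auto
  then have "(+) t ` {\<tau>. t + \<tau> \<in> {-a..a}} = {-a..a}"
    by simp
  moreover have "((\<lambda>\<tau>. g (upd x j (t + \<tau>))) has_real_derivative g' (upd x j t))
      (at 0 within {\<tau>. t + \<tau> \<in> {-a..a}})"
    using assms(1) mem [of t] assms(3) unfolding has_partial_on_def
    by (auto dest!: bspec [of _ _ "upd x j t"] simp: mem)
  ultimately show ?thesis
    using DERIV_at_within_shift [of "\<lambda>t. g (upd x j t)" "g' (upd x j t)" t 0 "{\<tau>. t + \<tau> \<in> {-a..a}}"]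
    by simp
qed

text \<open>Every point of the nondegenerate interval from \<open>-a\<close> to \<open>a\<close> is
  a limit point of it, so one-sided derivatives at the boundary are unique as well.\<close>

lemma has_partial_on_unique:
  assumes "0 < a" "has_partial_on (big_cube a) j g h" "has_partial_on (big_cube a) j g h'" "x \<in> big_cube a"
  shows "h x = h' x"
proof -
  have t: "x $ j \<in> {-a..a}" using assms by (simp add: mem_big_cube)
  then have "at (x $ j) within {-a..a} \<noteq> bot"
    using assms(1) by (simp add: trivial_limit_within islimpt_Icc)
  then show ?thesis
    using has_partial_on_line [OF assms(2,4) t] has_partial_on_line [OF assms(3,4) t]
    by (auto simp: has_field_derivative_iff intro: tendsto_unique)
qed

lemma has_partial_on_cong:
  assumes "has_partial_on U j g h" "\<And>x. x \<in> U \<Longrightarrow> g' x = g x" "\<And>x. x \<in> U \<Longrightarrow> h' x = h x"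
  shows "has_partial_on U j g' h'"
  unfolding has_partial_on_def
proof
  fix x assume x: "x \<in> U"
  then have "((\<lambda>t. g (x + t *\<^sub>R axis j 1)) has_real_derivative h' x) (at 0 within {t. x + t *\<^sub>R axis j 1 \<in> U})"
    using assms by (simp add: has_partial_on_def)
  then show "((\<lambda>t. g' (x + t *\<^sub>R axis j 1)) has_real_derivative h' x) (at 0 within {t. x + t *\<^sub>R axis j 1 \<in> U})"
    by (rule has_field_derivative_transform_within [OF _ zero_less_one]) (use x assms in auto)
qed

text \<open>The smoothness hypothesis yields a separate chain of witnesses for each multi-index. A
  choice operator replaces them by one family of derivatives, indexed by lists.\<close>

definition pd :: "(real ^ 'n) set \<Rightarrow> 'n \<Rightarrow> (real ^ 'n \<Rightarrow> real) \<Rightarrow> real ^ 'n \<Rightarrow> real" where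
  "pd U j g = (SOME h. has_partial_on U j g h)"

lemma has_partial_on_pd: "has_partial_on U j g h \<Longrightarrow> has_partial_on U j g (pd U j g)"
  unfolding pd_def by (rule someI [of "has_partial_on U j g"])

text \<open>By uniqueness, the chosen derivatives agree on the cube with every chain of witnesses;
  thus all chains fit together.\<close>

lemma has_iter_partial_on_foldr:
  assumes "0 < a" "has_iter_partial_on (big_cube a) js g h"
  shows "\<And>x. x \<in> big_cube a \<Longrightarrow> foldr (pd (big_cube a)) js g x = h x"
    and "js = j # vs \<Longrightarrow> has_partial_on (big_cube a) j (foldr (pd (big_cube a)) vs g) (foldr (pd (big_cube a)) js g)"
proof -
  let ?F = "\<lambda>js. foldr (pd (big_cube a)) js g"
  have "(\<forall>x \<in> big_cube a. ?F js x = h x) \<and>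
      (\<forall>j vs. js = j # vs \<longrightarrow> has_partial_on (big_cube a) j (?F vs) (?F js))"
    using assms(2)
  proof (induction js arbitrary: h)
    case (Cons i js)
    then obtain h' where h': "has_iter_partial_on (big_cube a) js g h'"
        "has_partial_on (big_cube a) i h' h" by auto
    then have "has_partial_on (big_cube a) i (?F js) h"
      using Cons.IH by (intro has_partial_on_cong [OF h'(2)]) auto
    moreover from this have "has_partial_on (big_cube a) i (?F js) (pd (big_cube a) i (?F js))"
      by (rule has_partial_on_pd)
    ultimately show ?case
      using has_partial_on_unique [OF assms(1)] by auto
  qed simp
  then show "\<And>x. x \<in> big_cube a \<Longrightarrow> ?F js x = h x"
    and "js = j # vs \<Longrightarrow> has_partial_on (big_cube a) j (?F vs) (?F js)"
    by auto
qed

lemma has_iter_partial_on_append: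
  "has_iter_partial_on U (us @ vs) g h \<Longrightarrow> \<exists>h'. has_iter_partial_on U vs g h'"
  by (induction us arbitrary: h) auto

section \<open>Derivatives on an interval: Taylor expansion and interpolation\<close>

definition deriv_chain :: "nat \<Rightarrow> real set \<Rightarrow> (nat \<Rightarrow> real \<Rightarrow> real) \<Rightarrow> bool" where
  "deriv_chain k S \<phi> \<longleftrightarrow>
     (\<forall>l<k. \<forall>t\<in>S. (\<phi> l has_real_derivative \<phi> (Suc l) t) (at t within S))"

lemma deriv_chain_mono:
  "deriv_chain k S \<phi> \<Longrightarrow> k' \<le> k \<Longrightarrow> S' \<subseteq> S \<Longrightarrow> deriv_chain k' S' \<phi>"
  unfolding deriv_chain_def by (meson DERIV_subset less_le_trans subsetD)

text \<open>Subtracting the degree \<open>k\<close> term first turns the top derivative into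
  \<open>\<phi> k t - \<phi> k z0\<close>. The usual remainder estimate of order \<open>k\<close>
  then needs only the oscillation of \<open>\<phi> k\<close>, which is what a Hoelder condition
  controls.\<close>

lemma taylor_1d:
  fixes \<phi> :: "nat \<Rightarrow> real \<Rightarrow> real"
  assumes "convex S" and z0: "z0 \<in> S" and z: "z \<in> S"
    and deriv: "deriv_chain k S \<phi>"
    and B: "\<And>t. t \<in> S \<Longrightarrow> \<bar>\<phi> k t - \<phi> k z0\<bar> \<le> B"
  shows "\<bar>\<phi> 0 z - (\<Sum>l\<le>k. \<phi> l z0 * (z - z0) ^ l / fact l)\<bar> \<le> B * \<bar>z - z0\<bar> ^ k"
proof (cases k)
  case 0
  then show ?thesis using B [OF z] by simp
next
  case (Suc n)
  define f where "f l t = \<phi> l t - \<phi> k z0 * ((t - z0) ^ (k - l) / fact (k - l))" for l t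
  have pow: "((\<lambda>t. (t - z0) ^ Suc i / fact (Suc i)) has_real_derivative (t - z0) ^ i / fact i) (at t within S)" for i t
    by (rule derivative_eq_intros refl | simp add: field_simps del: of_nat_Suc)+
  have "norm (f 0 z - (\<Sum>l\<le>n. f l z0 * (z - z0) ^ l / fact l)) \<le> B * norm (z - z0) ^ Suc n / fact n"
  proof (rule field_Taylor [OF assms(1) _ _ z0 z])
    fix i t assume t: "t \<in> S" and i: "i \<le> n"
    have k: "k - i = Suc (k - Suc i)" using i Suc by auto
    show "(f i has_real_derivative f (Suc i) t) (at t within S)"
      unfolding f_def k by (intro DERIV_diff DERIV_cmult pow) (use deriv t i Suc in \<open>auto simp: deriv_chain_def\<close>)
  next
    fix t assume "t \<in> S"
    then show "norm (f (Suc n) t) \<le> B"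
      using B by (simp add: f_def Suc)
  qed
  also have "(\<Sum>l\<le>n. f l z0 * (z - z0) ^ l / fact l) = (\<Sum>l\<le>n. \<phi> l z0 * (z - z0) ^ l / fact l)"
    by (intro sum.cong) (auto simp: f_def Suc)
  also have "f 0 z - (\<Sum>l\<le>n. \<phi> l z0 * (z - z0) ^ l / fact l)
      = \<phi> 0 z - (\<Sum>l\<le>k. \<phi> l z0 * (z - z0) ^ l / fact l)"
    by (simp add: f_def Suc)
  finally have "\<bar>\<phi> 0 z - (\<Sum>l\<le>k. \<phi> l z0 * (z - z0) ^ l / fact l)\<bar> \<le> B * \<bar>z - z0\<bar> ^ k / fact n"
    by (simp add: Suc)
  also have "\<dots> \<le> B * \<bar>z - z0\<bar> ^ k / 1"
    using B [OF z0] by (intro divide_left_mono) auto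
  finally show ?thesis by simp
qed

text \<open>Induction gives points in the left and right thirds where the \<open>k\<close>-th
  derivative is small. They are at least a third of the interval apart, so the mean value theorem
  yields a point between them where the next derivative is small.\<close>

lemma exists_small_derivative:
  fixes u v :: real
  assumes "u < v"
  shows "\<exists>K\<ge>0. \<forall>\<phi> A. deriv_chain k {u..v} \<phi> \<longrightarrow> (\<forall>t\<in>{u..v}. \<bar>\<phi> 0 t\<bar> \<le> A) \<longrightarrow>
    (\<exists>\<xi>\<in>{u..v}. \<bar>\<phi> k \<xi>\<bar> \<le> K * A)"
  using assms
proof (induction k arbitrary: u v)
  case 0
  then have "u \<in> {u..v}" by simp
  then show ?case by (intro exI [of _ 1]) force
next
  case (Suc k)
  define w where "w = (v - u) / 3"
  have w: "w > 0" using Suc.prems by (simp add: w_def)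
  have "u < u + w" "v - w < v" using w by auto
  note IH = Suc.IH [OF this(1)] Suc.IH [OF this(2)]
  obtain K1 where K1: "K1 \<ge> 0" and 1: "\<forall>\<phi> A. deriv_chain k {u..u+w} \<phi> \<longrightarrow>
      (\<forall>t\<in>{u..u+w}. \<bar>\<phi> 0 t\<bar> \<le> A) \<longrightarrow> (\<exists>\<xi>\<in>{u..u+w}. \<bar>\<phi> k \<xi>\<bar> \<le> K1 * A)"
    using IH(1) by blast
  obtain K2 where K2: "K2 \<ge> 0" and 2: "\<forall>\<phi> A. deriv_chain k {v-w..v} \<phi> \<longrightarrow>
      (\<forall>t\<in>{v-w..v}. \<bar>\<phi> 0 t\<bar> \<le> A) \<longrightarrow> (\<exists>\<xi>\<in>{v-w..v}. \<bar>\<phi> k \<xi>\<bar> \<le> K2 * A)"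
    using IH(2) by blast
  show ?case
  proof (intro exI [of _ "(K1 + K2) / w"] conjI allI impI)
    fix \<phi> :: "nat \<Rightarrow> real \<Rightarrow> real" and A :: real
    assume d: "deriv_chain (Suc k) {u..v} \<phi>" and A: "\<forall>t\<in>{u..v}. \<bar>\<phi> 0 t\<bar> \<le> A"
    have "{u..u+w} \<subseteq> {u..v}" "{v-w..v} \<subseteq> {u..v}"
      using Suc.prems by (auto simp: w_def field_simps)
    note sub = this
    have "deriv_chain k {u..u+w} \<phi>" "deriv_chain k {v-w..v} \<phi>"
      using d sub by (auto intro: deriv_chain_mono)
    moreover have "\<forall>t\<in>{u..u+w}. \<bar>\<phi> 0 t\<bar> \<le> A" "\<forall>t\<in>{v-w..v}. \<bar>\<phi> 0 t\<bar> \<le> A" using A sub by blast+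
    ultimately obtain p q where p: "p \<in> {u..u+w}" "\<bar>\<phi> k p\<bar> \<le> K1 * A"
      and q: "q \<in> {v-w..v}" "\<bar>\<phi> k q\<bar> \<le> K2 * A"
      using 1 2 by metis
    have pq: "w \<le> q - p" "p < q" "{p..q} \<subseteq> {u..v}" using p q w by (auto simp: w_def field_simps)
    have "deriv_chain (Suc k) {p..q} \<phi>" using d pq by (auto intro: deriv_chain_mono)
    then have "\<exists>\<xi>\<in>{p<..<q}. \<phi> k q - \<phi> k p = \<phi> (Suc k) \<xi> * (q - p)"
      by (intro mvt_simple pq has_field_derivative_imp_has_derivative) (auto simp: deriv_chain_def)
    then obtain \<xi> where \<xi>: "\<xi> \<in> {p<..<q}" "\<phi> k q - \<phi> k p = \<phi> (Suc k) \<xi> * (q - p)" by blast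
    have "\<bar>\<phi> (Suc k) \<xi>\<bar> * w \<le> \<bar>\<phi> (Suc k) \<xi>\<bar> * (q - p)"
      using pq by (intro mult_left_mono) auto
    also have "\<dots> = \<bar>\<phi> k q - \<phi> k p\<bar>" using \<xi> pq by (simp add: abs_mult)
    also have "\<dots> \<le> (K1 + K2) * A" using p(2) q(2) unfolding distrib_right by linarith
    finally have "\<bar>\<phi> (Suc k) \<xi>\<bar> \<le> (K1 + K2) / w * A" using w by (simp add: field_simps)
    moreover have "\<xi> \<in> {u..v}" using \<xi>(1) pq(3) by auto
    ultimately show "\<exists>\<xi>\<in>{u..v}. \<bar>\<phi> (Suc k) \<xi>\<bar> \<le> (K1 + K2) / w * A" by blast
  qed (use K1 K2 w in simp)
qed

text \<open>From a point where the \<open>k\<close>-th derivative is small, the bound on the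
  derivative of order \<open>Suc k\<close> spreads a bound over the whole interval. This lowers the
  top order by one, with a new \<open>B\<close>; hence the induction leaves \<open>B\<close>
  arbitrary.\<close>

lemma intermediate_derivatives_bounded:
  fixes u v A B :: real
  assumes "u < v"
  shows "\<exists>B'. \<forall>\<phi>. deriv_chain k {u..v} \<phi> \<longrightarrow> (\<forall>t\<in>{u..v}. \<bar>\<phi> 0 t\<bar> \<le> A) \<longrightarrow>
    (\<forall>t\<in>{u..v}. \<bar>\<phi> k t\<bar> \<le> B) \<longrightarrow> (\<forall>l\<le>k. \<forall>t\<in>{u..v}. \<bar>\<phi> l t\<bar> \<le> B')"
proof (induction k arbitrary: B)
  case 0
  then show ?case by auto
next
  case (Suc k)
  obtain K where K: "\<forall>\<phi> A. deriv_chain k {u..v} \<phi> \<longrightarrow> (\<forall>t\<in>{u..v}. \<bar>\<phi> 0 t\<bar> \<le> A) \<longrightarrow>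
      (\<exists>\<xi>\<in>{u..v}. \<bar>\<phi> k \<xi>\<bar> \<le> K * A)"
    using exists_small_derivative [OF assms, of k] by blast
  obtain B' where B': "\<forall>\<phi>. deriv_chain k {u..v} \<phi> \<longrightarrow> (\<forall>t\<in>{u..v}. \<bar>\<phi> 0 t\<bar> \<le> A) \<longrightarrow>
      (\<forall>t\<in>{u..v}. \<bar>\<phi> k t\<bar> \<le> K * A + B * (v - u)) \<longrightarrow> (\<forall>l\<le>k. \<forall>t\<in>{u..v}. \<bar>\<phi> l t\<bar> \<le> B')"
    using Suc.IH [of "K * A + B * (v - u)"] by blast
  show ?case
  proof (intro exI [of _ "max B B'"] allI impI)
    fix \<phi> :: "nat \<Rightarrow> real \<Rightarrow> real" and l
    assume d: "deriv_chain (Suc k) {u..v} \<phi>" and A: "\<forall>t\<in>{u..v}. \<bar>\<phi> 0 t\<bar> \<le> A"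
      and B: "\<forall>t\<in>{u..v}. \<bar>\<phi> (Suc k) t\<bar> \<le> B" and l: "l \<le> Suc k"
    have d': "deriv_chain k {u..v} \<phi>" using d by (auto intro: deriv_chain_mono)
    then obtain \<xi> where \<xi>: "\<xi> \<in> {u..v}" "\<bar>\<phi> k \<xi>\<bar> \<le> K * A" using K A by blast
    have B0: "B \<ge> 0" using B \<xi>(1) abs_ge_zero order_trans by blast
    have "\<bar>\<phi> k t\<bar> \<le> K * A + B * (v - u)" if t: "t \<in> {u..v}" for t
    proof -
      have "norm (\<phi> k t - \<phi> k \<xi>) \<le> B * norm (t - \<xi>)"
        by (rule field_differentiable_bound [of "{u..v}" _ "\<phi> (Suc k)"])
          (use d B t \<xi> in \<open>auto simp: deriv_chain_def\<close>)
      also have "\<dots> \<le> B * (v - u)" using B0 t \<xi> by (intro mult_left_mono) auto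
      finally have "\<bar>\<phi> k t - \<phi> k \<xi>\<bar> \<le> B * (v - u)" by simp
      then show ?thesis using \<xi>(2) by linarith
    qed
    then have "\<forall>l\<le>k. \<forall>t\<in>{u..v}. \<bar>\<phi> l t\<bar> \<le> B'" using B' d' A by blast
    then show "\<forall>t\<in>{u..v}. \<bar>\<phi> l t\<bar> \<le> max B B'"
      using l B by (cases "l = Suc k") (auto simp: le_max_iff_disj)
  qed
qed

section \<open>Multi-indices\<close>

definition monomial :: "nat ^ 'n \<Rightarrow> real ^ 'n \<Rightarrow> real" where
  "monomial \<gamma> x = (\<Prod>j\<in>UNIV. (x $ j) ^ (\<gamma> $ j))"

definition multi_indices :: "'n set \<Rightarrow> nat \<Rightarrow> (nat ^ 'n) set" where
  "multi_indices A k = {\<gamma>. (\<forall>j. j \<notin> A \<longrightarrow> \<gamma> $ j = 0) \<and> mi_norm \<gamma> \<le> k}"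

lemma mi_norm_upd: "mi_norm (upd \<gamma> j l) + \<gamma> $ j = mi_norm \<gamma> + l"
proof -
  have "(\<Sum>i\<in>UNIV - {j}. upd \<gamma> j l $ i) = (\<Sum>i\<in>UNIV - {j}. \<gamma> $ i)"
    by (intro sum.cong) (auto simp: upd_nth)
  then show ?thesis
    by (simp add: mi_norm_def sum.remove [of UNIV j])
qed

lemma monomial_upd: "monomial \<gamma> x = (x $ j) ^ (\<gamma> $ j) * monomial (upd \<gamma> j 0) (upd x j t)"
proof -
  have "(\<Prod>i\<in>UNIV - {j}. (upd x j t $ i) ^ (upd \<gamma> j 0 $ i)) = (\<Prod>i\<in>UNIV - {j}. (x $ i) ^ (\<gamma> $ i))"
    by (intro prod.cong) (auto simp: upd_nth)
  then show ?thesis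
    by (simp add: monomial_def prod.remove [of UNIV j])
qed

lemma component_le_mi_norm: "\<gamma> $ j \<le> mi_norm \<gamma>"
  unfolding mi_norm_def by (intro member_le_sum) auto

lemma finite_multi_indices [simp]: "finite (multi_indices A k :: (nat ^ 'n) set)"
proof (rule finite_subset)
  show "multi_indices A k \<subseteq> vec_lambda ` (PiE UNIV (\<lambda>_. {..k}) :: ('n \<Rightarrow> nat) set)"
  proof
    fix \<gamma> :: "nat ^ 'n" assume "\<gamma> \<in> multi_indices A k"
    then have "vec_nth \<gamma> \<in> PiE UNIV (\<lambda>_. {..k})"
      using component_le_mi_norm by (auto simp: multi_indices_def intro: order_trans)
    then show "\<gamma> \<in> vec_lambda ` (PiE UNIV (\<lambda>_. {..k}) :: ('n \<Rightarrow> nat) set)"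
      by (metis imageI vec_nth_inverse)
  qed
qed (simp add: finite_PiE)

lemma multi_indices_empty: "multi_indices {} k = {0}"
  by (auto simp: multi_indices_def vec_eq_iff mi_norm_def)

lemma multi_indices_UNIV: "multi_indices UNIV k = {\<gamma>. mi_norm \<gamma> \<le> k}"
  by (simp add: multi_indices_def)

text \<open>Grouping by the exponent of coordinate \<open>j\<close> merges nested one-coordinate
  expansions into one sum over multi-indices.\<close>

lemma sum_multi_indices_insert:
  assumes "j \<notin> A"
  shows "(\<Sum>\<gamma>\<in>multi_indices (insert j A) k. g (\<gamma> $ j) (upd \<gamma> j 0)) =
    (\<Sum>l\<le>k. \<Sum>\<gamma>\<in>multi_indices A (k - l). g l \<gamma>)"
proof -
  have "(\<Sum>l\<le>k. \<Sum>\<gamma>\<in>multi_indices A (k - l). g l \<gamma>) =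
      (\<Sum>(l, \<gamma>)\<in>Sigma {..k} (\<lambda>l. multi_indices A (k - l)). g l \<gamma>)"
    by (simp add: sum.Sigma)
  also have "\<dots> = (\<Sum>\<gamma>\<in>multi_indices (insert j A) k. g (\<gamma> $ j) (upd \<gamma> j 0))"
  proof (rule sum.reindex_bij_witness [of _ "\<lambda>\<gamma>. (\<gamma> $ j, upd \<gamma> j 0)" "\<lambda>(l, \<gamma>). upd \<gamma> j l"])
    fix p assume p: "p \<in> Sigma {..k} (\<lambda>l. multi_indices A (k - l))"
    obtain l \<gamma> where p': "p = (l, \<gamma>)" by (cases p)
    have "\<gamma> $ j = 0" using p p' assms by (auto simp: multi_indices_def)
    moreover from this have "upd \<gamma> j 0 = \<gamma>" by (metis upd_triv)
    ultimately show "((case p of (l, \<gamma>) \<Rightarrow> upd \<gamma> j l) $ j, upd (case p of (l, \<gamma>) \<Rightarrow> upd \<gamma> j l) j 0) = p"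
      and "(case p of (l, \<gamma>) \<Rightarrow> upd \<gamma> j l) \<in> multi_indices (insert j A) k"
      and "g ((case p of (l, \<gamma>) \<Rightarrow> upd \<gamma> j l) $ j) (upd (case p of (l, \<gamma>) \<Rightarrow> upd \<gamma> j l) j 0) =
        (case p of (l, \<gamma>) \<Rightarrow> g l \<gamma>)"
      using p p' mi_norm_upd [of \<gamma> j l] by (auto simp: multi_indices_def upd_nth)
  next
    fix \<gamma> assume "\<gamma> \<in> multi_indices (insert j A) k"
    then show "(\<gamma> $ j, upd \<gamma> j 0) \<in> Sigma {..k} (\<lambda>l. multi_indices A (k - l))"
      using mi_norm_upd [of \<gamma> j 0] by (auto simp: multi_indices_def upd_nth)
  qed simp
  finally show ?thesis ..
qed

lemma power_mult_powr:
  fixes x :: real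
  assumes "0 \<le> x" "0 < s"
  shows "x ^ l * x powr (real k + s) = x powr (real (l + k) + s)"
proof (cases "x = 0")
  case False
  then have "0 < x" using assms by simp
  then show ?thesis by (simp add: powr_add powr_realpow power_add)
qed simp

section \<open>Taylor approximation with ordered derivatives\<close>

text \<open>\<open>F js\<close> is meant to be the iterated partial derivative along \<open>js\<close> (the head is differentiated last). Only
  \<^emph>\<open>sorted\<close> lists are covered, as nothing is known about derivatives taken in another order.\<close>

locale ordered_partials =
  fixes a s C :: real and \<theta> :: nat
    and F :: "'n::{finite,linorder} list \<Rightarrow> real ^ 'n::{finite,linorder} \<Rightarrow> real"
  assumes a: "0 < a" and s: "0 < s" and C: "0 \<le> C"
    and partial: "sorted (j # vs) \<Longrightarrow> length vs < \<theta> \<Longrightarrow>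
      has_partial_on (big_cube a) j (F vs) (F (j # vs))"
    and hoelder: "sorted vs \<Longrightarrow> length vs = \<theta> \<Longrightarrow> x \<in> big_cube a \<Longrightarrow> z \<in> big_cube a \<Longrightarrow>
      \<bar>F vs x - F vs z\<bar> \<le> C * norm (x - z) powr s"
begin

lemma sorted_replicate_append:
  "sorted vs \<Longrightarrow> \<forall>v\<in>set vs. j \<le> v \<Longrightarrow> sorted (replicate l j @ vs)"
  by (auto simp: sorted_append sorted_replicate)

lemma deriv_chain_line:
  assumes "sorted vs" "\<forall>v\<in>set vs. j \<le> v" "length vs + k = \<theta>" "x \<in> big_cube a"
  shows "deriv_chain k {-a..a} (\<lambda>l t. F (replicate l j @ vs) (upd x j t))"
  unfolding deriv_chain_def
proof (intro allI impI ballI)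
  fix l t assume l: "l < k" and t: "t \<in> {-a..a}"
  have "sorted (j # replicate l j @ vs)"
    using sorted_replicate_append [OF assms(1,2), of "Suc l"] by simp
  then have "has_partial_on (big_cube a) j (F (replicate l j @ vs)) (F (j # replicate l j @ vs))"
    using l assms by (intro partial) auto
  from has_partial_on_line [OF this assms(4) t]
  show "((\<lambda>t. F (replicate l j @ vs) (upd x j t)) has_real_derivative
      F (replicate (Suc l) j @ vs) (upd x j t)) (at t within {-a..a})" by simp
qed

lemma taylor_line:
  assumes "sorted vs" "\<forall>v\<in>set vs. j \<le> v" "length vs + k = \<theta>" "x \<in> big_cube a" "t0 \<in> {-a..a}"
  shows "\<bar>F vs x - (\<Sum>l\<le>k. F (replicate l j @ vs) (upd x j t0) * (x $ j - t0) ^ l / fact l)\<bar>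
    \<le> C * (\<bar>x $ j - t0\<bar> ^ k * \<bar>x $ j - t0\<bar> powr s)"
proof -
  \<comment> \<open>On the segment, unlike on all of \<open>{-a..a}\<close>, the Hoelder bound is in
    terms of \<open>\<bar>x $ j - t0\<bar>\<close>.\<close>
  define S where "S = closed_segment t0 (x $ j)"
  have xj: "x $ j \<in> {-a..a}" using assms(4) by (simp add: mem_big_cube)
  have S: "S \<subseteq> {-a..a}"
    unfolding S_def using assms(5) xj by (intro closed_segment_subset) auto
  have "\<bar>F (replicate 0 j @ vs) (upd x j (x $ j)) -
      (\<Sum>l\<le>k. F (replicate l j @ vs) (upd x j t0) * (x $ j - t0) ^ l / fact l)\<bar>
    \<le> (C * \<bar>x $ j - t0\<bar> powr s) * \<bar>x $ j - t0\<bar> ^ k"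
  proof (rule taylor_1d [of S])
    show "deriv_chain k S (\<lambda>l t. F (replicate l j @ vs) (upd x j t))"
      using deriv_chain_mono [OF deriv_chain_line [OF assms(1-4)] order_refl S] .
    fix t assume t: "t \<in> S"
    have "\<bar>F (replicate k j @ vs) (upd x j t) - F (replicate k j @ vs) (upd x j t0)\<bar>
        \<le> C * norm (upd x j t - upd x j t0) powr s"
      using assms t S by (intro hoelder sorted_replicate_append upd_mem_big_cube) auto
    also have "\<dots> \<le> C * \<bar>x $ j - t0\<bar> powr s"
      unfolding norm_diff_upd using t C s
      by (intro mult_left_mono powr_mono2) (auto simp: S_def closed_segment_eq_real_ivl split: if_splits)
    finally show "\<bar>F (replicate k j @ vs) (upd x j t) - F (replicate k j @ vs) (upd x j t0)\<bar>
        \<le> C * \<bar>x $ j - t0\<bar> powr s" .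
  qed (auto simp: S_def)
  then show ?thesis by (simp add: mult_ac)
qed

text \<open>Induction adds to \<open>A\<close> a coordinate \<open>j\<close> above all others.
  Expanding \<open>F vs\<close> in direction \<open>j\<close> produces
  \<open>F (replicate l j @ vs)\<close>, still sorted, at points that differ from \<open>c\<close>
  only on \<open>A\<close>, with remaining order \<open>k - l\<close>. The constant \<open>K\<close>
  is chosen before \<open>vs\<close>, \<open>c\<close> and \<open>B\<close>.\<close>

lemma taylor:
  assumes "finite A"
  shows "\<exists>K\<ge>0. \<forall>vs c B. sorted vs \<longrightarrow> (\<forall>v\<in>set vs. \<forall>u\<in>A. u \<le> v) \<longrightarrow> length vs + k = \<theta> \<longrightarrow>
    c \<in> big_cube a \<longrightarrow> (\<forall>ws. sorted ws \<longrightarrow> length ws \<le> \<theta> \<longrightarrow> \<bar>F ws c\<bar> \<le> B) \<longrightarrow>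
    (\<exists>b. (\<forall>\<gamma>. \<bar>b \<gamma>\<bar> \<le> B) \<and> (\<forall>x\<in>big_cube a. (\<forall>i. i \<notin> A \<longrightarrow> x $ i = c $ i) \<longrightarrow>
      \<bar>F vs x - (\<Sum>\<gamma>\<in>multi_indices A k. b \<gamma> * monomial \<gamma> (x - c))\<bar> \<le> K * norm (x - c) powr (real k + s)))"
  using assms
proof (induction A arbitrary: k rule: finite_linorder_max_induct)
  case empty
  show ?case
  proof (intro exI [of _ 0] conjI allI impI)
    fix vs :: "'n list" and c and B :: real
    assume "sorted vs" "length vs + k = \<theta>" "\<forall>ws. sorted ws \<longrightarrow> length ws \<le> \<theta> \<longrightarrow> \<bar>F ws c\<bar> \<le> B"
    then have "\<bar>F vs c\<bar> \<le> B" by auto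
    then show "\<exists>b. (\<forall>\<gamma>. \<bar>b \<gamma>\<bar> \<le> B) \<and> (\<forall>x\<in>big_cube a. (\<forall>i. i \<notin> {} \<longrightarrow> x $ i = c $ i) \<longrightarrow>
      \<bar>F vs x - (\<Sum>\<gamma>\<in>multi_indices {} k. b \<gamma> * monomial \<gamma> (x - c))\<bar> \<le> 0 * norm (x - c) powr (real k + s))"
      by (intro exI [of _ "\<lambda>_. F vs c"]) (auto simp: multi_indices_empty monomial_def simp flip: vec_eq_iff)
  qed simp
next
  case (insert j A)
  define P where "P A k K vs c B b \<longleftrightarrow> (\<forall>\<gamma>. \<bar>b \<gamma>\<bar> \<le> B) \<and> (\<forall>x\<in>big_cube a. (\<forall>i. i \<notin> A \<longrightarrow> x $ i = c $ i) \<longrightarrow>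
      \<bar>F vs x - (\<Sum>\<gamma>\<in>multi_indices A k. b \<gamma> * monomial \<gamma> (x - c))\<bar> \<le> K * norm (x - c) powr (real k + s))"
    for A k K vs c B b
  have jA: "j \<notin> A" using insert.hyps by auto
  have "\<forall>k. \<exists>K\<ge>0. \<forall>vs c B. sorted vs \<longrightarrow> (\<forall>v\<in>set vs. \<forall>u\<in>A. u \<le> v) \<longrightarrow> length vs + k = \<theta> \<longrightarrow>
    c \<in> big_cube a \<longrightarrow> (\<forall>ws. sorted ws \<longrightarrow> length ws \<le> \<theta> \<longrightarrow> \<bar>F ws c\<bar> \<le> B) \<longrightarrow> (\<exists>b. P A k K vs c B b)"
    using insert.IH unfolding P_def by blast
  then obtain K where K: "\<forall>k. K k \<ge> 0 \<and> (\<forall>vs c B. sorted vs \<longrightarrow> (\<forall>v\<in>set vs. \<forall>u\<in>A. u \<le> v) \<longrightarrow>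
    length vs + k = \<theta> \<longrightarrow> c \<in> big_cube a \<longrightarrow> (\<forall>ws. sorted ws \<longrightarrow> length ws \<le> \<theta> \<longrightarrow> \<bar>F ws c\<bar> \<le> B) \<longrightarrow>
    (\<exists>b. P A k (K k) vs c B b))"
    unfolding choice_iff by blast
  have "\<exists>b. P (insert j A) k (C + (\<Sum>l\<le>k. K (k - l))) vs c B b"
    if vs: "sorted vs" "\<forall>v\<in>set vs. \<forall>u\<in>insert j A. u \<le> v" "length vs + k = \<theta>"
      and c: "c \<in> big_cube a" and B: "\<forall>ws. sorted ws \<longrightarrow> length ws \<le> \<theta> \<longrightarrow> \<bar>F ws c\<bar> \<le> B" for vs c B
  proof -
    have cj: "c $ j \<in> {-a..a}" using c by (simp add: mem_big_cube)
    have B0: "0 \<le> B" using B vs by (metis abs_ge_zero le_add1 order_trans)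
    have "\<exists>b. P A (k - l) (K (k - l)) (replicate l j @ vs) c B b" if l: "l \<le> k" for l
    proof -
      have "sorted (replicate l j @ vs)" using vs by (intro sorted_replicate_append) auto
      moreover have "\<forall>v\<in>set (replicate l j @ vs). \<forall>u\<in>A. u \<le> v" using vs insert.hyps by fastforce
      moreover have "length (replicate l j @ vs) + (k - l) = \<theta>" using l vs by simp
      ultimately show ?thesis using K c B by blast
    qed
    then obtain b where b: "\<And>l. l \<le> k \<Longrightarrow> P A (k - l) (K (k - l)) (replicate l j @ vs) c B (b l)"
      by metis
    \<comment> \<open>The cutoff at 0 is there because \<open>b l\<close> is controlled only for
      \<open>l \<le> k\<close>, whereas the bound \<open>B\<close> is claimed for every
      multi-index.\<close>
    define b' where "b' \<gamma> = (if \<gamma> $ j \<le> k then b (\<gamma> $ j) (upd \<gamma> j 0) / fact (\<gamma> $ j) else 0)" for \<gamma>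
    have "\<bar>b' \<gamma>\<bar> \<le> B" for \<gamma>
    proof (cases "\<gamma> $ j \<le> k")
      case True
      then have "\<bar>b (\<gamma> $ j) (upd \<gamma> j 0)\<bar> \<le> B" using b by (simp add: P_def)
      then have "\<bar>b (\<gamma> $ j) (upd \<gamma> j 0)\<bar> / fact (\<gamma> $ j) \<le> B / 1"
        by (intro frac_le) auto
      then show ?thesis using True by (simp add: b'_def abs_divide)
    qed (simp add: b'_def B0)
    moreover have "\<bar>F vs x - (\<Sum>\<gamma>\<in>multi_indices (insert j A) k. b' \<gamma> * monomial \<gamma> (x - c))\<bar>
        \<le> (C + (\<Sum>l\<le>k. K (k - l))) * norm (x - c) powr (real k + s)"
      if x: "x \<in> big_cube a" and xc: "\<forall>i. i \<notin> insert j A \<longrightarrow> x $ i = c $ i" for x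
    proof -
      \<comment> \<open>The coefficients of the expansion in direction \<open>j\<close> are
        evaluated at this point; it agrees with \<open>c\<close> off \<open>A\<close>, so the
        induction hypothesis applies to it.\<close>
      define x' where "x' = upd x j (c $ j)"
      define d where "d = x $ j - c $ j"
      have d: "\<bar>d\<bar> \<le> norm (x - c)" unfolding d_def using component_le_norm_cart [of "x - c" j] by simp
      have x': "x' \<in> big_cube a" "\<forall>i. i \<notin> A \<longrightarrow> x' $ i = c $ i"
        using upd_mem_big_cube [OF x cj] xc by (auto simp: x'_def upd_nth)
      have nx': "norm (x' - c) \<le> norm (x - c)"
        by (rule norm_le_componentwise_cart) (simp add: x'_def upd_nth)
      have updx: "upd (x - c) j 0 = x' - c" by (simp add: x'_def vec_eq_iff upd_nth)
      define p where "p l = (\<Sum>\<gamma>\<in>multi_indices A (k - l). b l \<gamma> * monomial \<gamma> (x' - c))" for l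
      have "(\<Sum>\<gamma>\<in>multi_indices (insert j A) k. b' \<gamma> * monomial \<gamma> (x - c)) =
          (\<Sum>\<gamma>\<in>multi_indices (insert j A) k.
            b (\<gamma> $ j) (upd \<gamma> j 0) / fact (\<gamma> $ j) * (d ^ (\<gamma> $ j) * monomial (upd \<gamma> j 0) (x' - c)))"
      proof (rule sum.cong)
        fix \<gamma> :: "nat ^ 'n::{finite,linorder}" assume "\<gamma> \<in> multi_indices (insert j A) k"
        then have "\<gamma> $ j \<le> k" using component_le_mi_norm [of \<gamma> j] by (auto simp: multi_indices_def)
        then show "b' \<gamma> * monomial \<gamma> (x - c) =
            b (\<gamma> $ j) (upd \<gamma> j 0) / fact (\<gamma> $ j) * (d ^ (\<gamma> $ j) * monomial (upd \<gamma> j 0) (x' - c))"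
          unfolding monomial_upd [of \<gamma> "x - c" j 0] updx by (simp add: b'_def d_def)
      qed simp
      also have "\<dots> = (\<Sum>l\<le>k. \<Sum>\<gamma>\<in>multi_indices A (k - l). b l \<gamma> / fact l * (d ^ l * monomial \<gamma> (x' - c)))"
        by (rule sum_multi_indices_insert [OF jA])
      also have "\<dots> = (\<Sum>l\<le>k. p l * d ^ l / fact l)"
        unfolding p_def by (simp add: sum_distrib_left sum_distrib_right sum_divide_distrib mult_ac)
      finally have sum_eq: "(\<Sum>\<gamma>\<in>multi_indices (insert j A) k. b' \<gamma> * monomial \<gamma> (x - c)) =
          (\<Sum>l\<le>k. p l * d ^ l / fact l)" .
      define q where "q l = F (replicate l j @ vs) x'" for l
      have 1: "\<bar>F vs x - (\<Sum>l\<le>k. q l * d ^ l / fact l)\<bar> \<le> C * norm (x - c) powr (real k + s)"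
      proof -
        have "\<bar>F vs x - (\<Sum>l\<le>k. q l * d ^ l / fact l)\<bar> \<le> C * (\<bar>d\<bar> ^ k * \<bar>d\<bar> powr s)"
          unfolding q_def d_def x'_def using vs x cj by (intro taylor_line) auto
        also have "\<bar>d\<bar> ^ k * \<bar>d\<bar> powr s = \<bar>d\<bar> powr (real k + s)"
          using power_mult_powr [of "\<bar>d\<bar>" s k 0] s by simp
        also have "C * \<dots> \<le> C * norm (x - c) powr (real k + s)"
          using C d s by (intro mult_left_mono powr_mono2) auto
        finally show ?thesis .
      qed
      \<comment> \<open>The coefficient of \<open>d ^ l\<close> is approximated only to order
        \<open>k - l + s\<close>; the factor \<open>d ^ l\<close> restores the order
        \<open>k + s\<close>.\<close>
      have 2: "\<bar>(q l - p l) * d ^ l / fact l\<bar> \<le> K (k - l) * norm (x - c) powr (real k + s)"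
        if l: "l \<le> k" for l
      proof -
        have "\<bar>(q l - p l) * d ^ l / fact l\<bar> = \<bar>q l - p l\<bar> * \<bar>d\<bar> ^ l / fact l"
          by (simp add: abs_mult power_abs)
        also have "\<dots> \<le> \<bar>q l - p l\<bar> * \<bar>d\<bar> ^ l / 1"
          by (intro divide_left_mono) auto
        also have "\<dots> \<le> (K (k - l) * norm (x - c) powr (real (k - l) + s)) * norm (x - c) ^ l / 1"
        proof (intro divide_right_mono mult_mono power_mono d)
          have "\<bar>q l - p l\<bar> \<le> K (k - l) * norm (x' - c) powr (real (k - l) + s)"
            using b [OF l] x' by (simp add: P_def q_def p_def)
          also have "\<dots> \<le> K (k - l) * norm (x - c) powr (real (k - l) + s)"
            using K nx' s by (intro mult_left_mono powr_mono2) auto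
          finally show "\<bar>q l - p l\<bar> \<le> K (k - l) * norm (x - c) powr (real (k - l) + s)" .
        qed (use K in auto)
        also have "\<dots> = K (k - l) * norm (x - c) powr (real k + s)"
          using power_mult_powr [of "norm (x - c)" s l "k - l"] s l by (simp add: mult_ac)
        finally show ?thesis .
      qed
      have "F vs x - (\<Sum>l\<le>k. p l * d ^ l / fact l) =
          (F vs x - (\<Sum>l\<le>k. q l * d ^ l / fact l)) + (\<Sum>l\<le>k. (q l - p l) * d ^ l / fact l)"
        by (simp add: left_diff_distrib diff_divide_distrib sum_subtractf)
      also have "\<bar>\<dots>\<bar> \<le> C * norm (x - c) powr (real k + s) + (\<Sum>l\<le>k. K (k - l) * norm (x - c) powr (real k + s))"
        using 1 2 by (intro order_trans [OF abs_triangle_ineq] add_mono order_trans [OF sum_abs] sum_mono) auto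
      also have "\<dots> = (C + (\<Sum>l\<le>k. K (k - l))) * norm (x - c) powr (real k + s)"
        by (simp add: distrib_right sum_distrib_right)
      finally show ?thesis unfolding sum_eq .
    qed
    ultimately have "P (insert j A) k (C + (\<Sum>l\<le>k. K (k - l))) vs c B b'"
      unfolding P_def by blast
    then show ?thesis by (rule exI [of _ b'])
  qed
  moreover have "C + (\<Sum>l\<le>k. K (k - l)) \<ge> 0"
    using C K by (intro add_nonneg_nonneg sum_nonneg) auto
  ultimately show ?case unfolding P_def by blast
qed

lemma taylor_UNIV:
  "\<exists>K\<ge>0. \<forall>c B. c \<in> big_cube a \<longrightarrow> (\<forall>ws. sorted ws \<longrightarrow> length ws \<le> \<theta> \<longrightarrow> \<bar>F ws c\<bar> \<le> B) \<longrightarrow>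
    (\<exists>b. (\<forall>\<gamma>. \<bar>b \<gamma>\<bar> \<le> B) \<and> (\<forall>x\<in>big_cube a.
      \<bar>F [] x - (\<Sum>\<gamma> | mi_norm \<gamma> \<le> \<theta>. b \<gamma> * monomial \<gamma> (x - c))\<bar> \<le> K * norm (x - c) powr (real \<theta> + s)))"
proof -
  let ?P = "\<lambda>K vs k c b. \<forall>x\<in>big_cube a. (\<forall>i. i \<notin> UNIV \<longrightarrow> x $ i = c $ i) \<longrightarrow>
    \<bar>F vs x - (\<Sum>\<gamma>\<in>multi_indices UNIV k. b \<gamma> * monomial \<gamma> (x - c))\<bar> \<le> K * norm (x - c) powr (real k + s)"
  obtain K where "0 \<le> K" and K: "\<forall>vs c B. sorted vs \<longrightarrow> (\<forall>v\<in>set vs. \<forall>u\<in>UNIV. u \<le> v) \<longrightarrow>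
    length vs + \<theta> = \<theta> \<longrightarrow> c \<in> big_cube a \<longrightarrow> (\<forall>ws. sorted ws \<longrightarrow> length ws \<le> \<theta> \<longrightarrow> \<bar>F ws c\<bar> \<le> B) \<longrightarrow>
    (\<exists>b. (\<forall>\<gamma>. \<bar>b \<gamma>\<bar> \<le> B) \<and> ?P K vs \<theta> c b)"
    using taylor [OF finite, of UNIV \<theta>] by (elim exE conjE)
  show ?thesis
    using \<open>0 \<le> K\<close> K [THEN spec [of _ "[]"]] by (auto simp: multi_indices_UNIV)
qed

section \<open>Bounds on all ordered derivatives, uniform over the cube\<close>

lemma finite_sorted_lists: "finite {ws :: 'n list. sorted ws \<and> length ws \<le> \<theta>}"
  by (rule finite_subset [OF _ finite_lists_length_le [OF finite, of UNIV \<theta>]]) auto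

text \<open>At a single centre only finitely many numbers occur, so the bound that
  \<open>taylor_UNIV\<close> requires is available there without any uniformity.\<close>

lemma bounded_at: "\<exists>B. \<forall>ws. sorted ws \<longrightarrow> length ws \<le> \<theta> \<longrightarrow> \<bar>F ws c\<bar> \<le> B"
proof -
  have "\<bar>F ws c\<bar> \<le> (\<Sum>ws | sorted ws \<and> length ws \<le> \<theta>. \<bar>F ws c\<bar>)" if "sorted ws" "length ws \<le> \<theta>" for ws
    using that by (intro member_le_sum finite_sorted_lists) auto
  then show ?thesis by blast
qed

lemma compact_big_cube: "compact (big_cube a :: (real ^ 'n::{finite,linorder}) set)"
  by (simp add: big_cube_def)

lemma zero_mem_big_cube: "0 \<in> big_cube a"
  using a by (simp add: mem_big_cube)

lemma norm_big_cube_bounded: "\<exists>D. \<forall>x :: real ^ 'n::{finite,linorder}. x \<in> big_cube a \<longrightarrow> norm x \<le> D"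
  using compact_imp_bounded [OF compact_big_cube] unfolding bounded_iff by auto

lemma bounded_Nil: "\<exists>B. \<forall>x\<in>big_cube a. \<bar>F [] x\<bar> \<le> B"
proof -
  obtain B where B: "\<forall>ws. sorted ws \<longrightarrow> length ws \<le> \<theta> \<longrightarrow> \<bar>F ws 0\<bar> \<le> B" using bounded_at [of 0] ..
  obtain D where D: "\<forall>x :: real ^ 'n::{finite,linorder}. x \<in> big_cube a \<longrightarrow> norm x \<le> D"
    using norm_big_cube_bounded ..
  obtain K where K: "K \<ge> 0" and taylor: "\<forall>c B. c \<in> big_cube a \<longrightarrow>
      (\<forall>ws. sorted ws \<longrightarrow> length ws \<le> \<theta> \<longrightarrow> \<bar>F ws c\<bar> \<le> B) \<longrightarrow>
      (\<exists>b. (\<forall>\<gamma>. \<bar>b \<gamma>\<bar> \<le> B) \<and> (\<forall>x\<in>big_cube a.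
        \<bar>F [] x - (\<Sum>\<gamma> | mi_norm \<gamma> \<le> \<theta>. b \<gamma> * monomial \<gamma> (x - c))\<bar> \<le> K * norm (x - c) powr (real \<theta> + s)))"
    using taylor_UNIV by (elim exE conjE)
  have "\<exists>b. (\<forall>\<gamma>. \<bar>b \<gamma>\<bar> \<le> B) \<and> (\<forall>x\<in>big_cube a.
      \<bar>F [] x - (\<Sum>\<gamma> | mi_norm \<gamma> \<le> \<theta>. b \<gamma> * monomial \<gamma> (x - 0))\<bar> \<le> K * norm (x - 0) powr (real \<theta> + s))"
    by (rule taylor [rule_format, OF zero_mem_big_cube]) (use B in blast)
  then obtain b where b: "\<forall>x\<in>big_cube a.
      \<bar>F [] x - (\<Sum>\<gamma> | mi_norm \<gamma> \<le> \<theta>. b \<gamma> * monomial \<gamma> (x - 0))\<bar> \<le> K * norm (x - 0) powr (real \<theta> + s)"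
    by (elim exE conjE)
  define p where "p x = (\<Sum>\<gamma> | mi_norm \<gamma> \<le> \<theta>. b \<gamma> * monomial \<gamma> x)" for x
  have "continuous_on (big_cube a) p"
    unfolding p_def monomial_def by (intro continuous_intros)
  then have "bounded (p ` big_cube a)"
    by (intro compact_imp_bounded compact_continuous_image compact_big_cube)
  then obtain E where E: "\<And>x. x \<in> big_cube a \<Longrightarrow> \<bar>p x\<bar> \<le> E"
    unfolding bounded_iff by auto
  have "\<bar>F [] x\<bar> \<le> E + K * D powr (real \<theta> + s)" if x: "x \<in> big_cube a" for x
  proof -
    have "\<bar>F [] x - p x\<bar> \<le> K * norm x powr (real \<theta> + s)" using b x by (simp add: p_def)
    also have "\<dots> \<le> K * D powr (real \<theta> + s)"
      using K D [rule_format, OF x] s by (intro mult_left_mono powr_mono2) auto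
    finally show ?thesis using E [OF x] by linarith
  qed
  then show ?thesis by blast
qed

lemma bounded_top:
  assumes "sorted vs" "length vs = \<theta>"
  shows "\<exists>B. \<forall>x\<in>big_cube a. \<bar>F vs x\<bar> \<le> B"
proof -
  obtain D where D: "\<forall>x :: real ^ 'n::{finite,linorder}. x \<in> big_cube a \<longrightarrow> norm x \<le> D"
    using norm_big_cube_bounded ..
  have "\<bar>F vs x\<bar> \<le> \<bar>F vs 0\<bar> + C * D powr s" if x: "x \<in> big_cube a" for x
  proof -
    have "\<bar>F vs x - F vs 0\<bar> \<le> C * norm (x - 0) powr s" by (intro hoelder assms x zero_mem_big_cube)
    also have "\<dots> \<le> C * D powr s" using C D [rule_format, OF x] s by (intro mult_left_mono powr_mono2) auto
    finally show ?thesis by linarith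
  qed
  then show ?thesis by blast
qed

text \<open>For a new head \<open>j\<close>, the tail is bounded by induction, and filling up with
  copies of \<open>j\<close> to order \<open>\<theta>\<close> gives a function bounded by the
  Hoelder condition. Interpolation along lines in direction \<open>j\<close> bounds everything
  between, in particular the first derivative of the tail.\<close>

lemma bounded_sorted:
  assumes "sorted vs" "length vs \<le> \<theta>"
  shows "\<exists>B. \<forall>x\<in>big_cube a. \<bar>F vs x\<bar> \<le> B"
  using assms
proof (induction vs)
  case Nil
  show ?case by (rule bounded_Nil)
next
  case (Cons j vs)
  define k where "k = \<theta> - length vs"
  have k: "length vs + k = \<theta>" "1 \<le> k" using Cons.prems by (auto simp: k_def)
  have vs: "sorted vs" "\<forall>v\<in>set vs. j \<le> v" using Cons.prems by auto
  obtain A where A: "\<And>x. x \<in> big_cube a \<Longrightarrow> \<bar>F vs x\<bar> \<le> A" using Cons by auto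
  obtain B where B: "\<And>x. x \<in> big_cube a \<Longrightarrow> \<bar>F (replicate k j @ vs) x\<bar> \<le> B"
    using bounded_top [of "replicate k j @ vs"] sorted_replicate_append [OF vs] k by auto
  obtain B' where B': "\<forall>\<phi>. deriv_chain k {-a..a} \<phi> \<longrightarrow> (\<forall>t\<in>{-a..a}. \<bar>\<phi> 0 t\<bar> \<le> A) \<longrightarrow>
    (\<forall>t\<in>{-a..a}. \<bar>\<phi> k t\<bar> \<le> B) \<longrightarrow> (\<forall>l\<le>k. \<forall>t\<in>{-a..a}. \<bar>\<phi> l t\<bar> \<le> B')"
    using intermediate_derivatives_bounded [of "-a" a k A B] a by auto
  have "\<bar>F (j # vs) x\<bar> \<le> B'" if x: "x \<in> big_cube a" for x
  proof -
    let ?\<phi> = "\<lambda>l t. F (replicate l j @ vs) (upd x j t)"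
    have "\<forall>t\<in>{-a..a}. \<bar>?\<phi> 0 t\<bar> \<le> A" "\<forall>t\<in>{-a..a}. \<bar>?\<phi> k t\<bar> \<le> B"
      using A [OF upd_mem_big_cube [OF x]] B [OF upd_mem_big_cube [OF x]] by simp_all
    then have "\<forall>l\<le>k. \<forall>t\<in>{-a..a}. \<bar>?\<phi> l t\<bar> \<le> B'"
      using B' deriv_chain_line [OF vs k(1) x] by blast
    then have "\<forall>t\<in>{-a..a}. \<bar>?\<phi> 1 t\<bar> \<le> B'" using k(2) by blast
    moreover have "x $ j \<in> {-a..a}" using x by (simp add: mem_big_cube)
    ultimately have "\<bar>?\<phi> 1 (x $ j)\<bar> \<le> B'" by blast
    then show ?thesis by simp
  qed
  then show ?case by blast
qed

lemma bounded_all: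
  "\<exists>B. \<forall>vs x. sorted vs \<longrightarrow> length vs \<le> \<theta> \<longrightarrow> x \<in> big_cube a \<longrightarrow> \<bar>F vs x\<bar> \<le> B"
proof -
  have "\<forall>vs. \<exists>B. sorted vs \<longrightarrow> length vs \<le> \<theta> \<longrightarrow> (\<forall>x\<in>big_cube a. \<bar>F vs x\<bar> \<le> B)"
    using bounded_sorted by blast
  then obtain b where b: "\<And>vs x. sorted vs \<Longrightarrow> length vs \<le> \<theta> \<Longrightarrow> x \<in> big_cube a \<Longrightarrow> \<bar>F vs x\<bar> \<le> b vs"
    unfolding choice_iff by blast
  have "\<bar>F vs x\<bar> \<le> (\<Sum>vs | sorted vs \<and> length vs \<le> \<theta>. b vs)"
    if vs: "sorted vs" "length vs \<le> \<theta>" and x: "x \<in> big_cube a" for vs x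
  proof -
    have "b vs \<le> (\<Sum>vs | sorted vs \<and> length vs \<le> \<theta>. b vs)"
      using vs b [OF _ _ x] by (intro member_le_sum finite_sorted_lists) (auto intro: order_trans [OF abs_ge_zero])
    then show ?thesis using b [OF vs x] by linarith
  qed
  then show ?thesis by blast
qed

text \<open>\<open>K\<close> and \<open>B\<close> precede the centre: this makes the final constant
  independent of the cube and of \<open>M\<close>.\<close>

lemma uniform_taylor:
  "\<exists>K B. 0 \<le> K \<and> 0 \<le> B \<and> (\<forall>c\<in>big_cube a. \<exists>b. (\<forall>\<gamma>. \<bar>b \<gamma>\<bar> \<le> B) \<and>
    (\<forall>x\<in>big_cube a. \<bar>F [] x - (\<Sum>\<gamma> | mi_norm \<gamma> \<le> \<theta>. b \<gamma> * monomial \<gamma> (x - c))\<bar>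
      \<le> K * norm (x - c) powr (real \<theta> + s)))"
proof -
  obtain B where B: "\<forall>vs x. sorted vs \<longrightarrow> length vs \<le> \<theta> \<longrightarrow> x \<in> big_cube a \<longrightarrow> \<bar>F vs x\<bar> \<le> B"
    using bounded_all by blast
  have "\<bar>F [] 0\<bar> \<le> B" by (intro B [rule_format] zero_mem_big_cube) auto
  then have "0 \<le> B" by linarith
  moreover obtain K where "0 \<le> K" and taylor: "\<forall>c B. c \<in> big_cube a \<longrightarrow>
      (\<forall>ws. sorted ws \<longrightarrow> length ws \<le> \<theta> \<longrightarrow> \<bar>F ws c\<bar> \<le> B) \<longrightarrow>
      (\<exists>b. (\<forall>\<gamma>. \<bar>b \<gamma>\<bar> \<le> B) \<and> (\<forall>x\<in>big_cube a.
        \<bar>F [] x - (\<Sum>\<gamma> | mi_norm \<gamma> \<le> \<theta>. b \<gamma> * monomial \<gamma> (x - c))\<bar> \<le> K * norm (x - c) powr (real \<theta> + s)))"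
    using taylor_UNIV by (elim exE conjE)
  moreover have "\<exists>b. (\<forall>\<gamma>. \<bar>b \<gamma>\<bar> \<le> B) \<and>
    (\<forall>x\<in>big_cube a. \<bar>F [] x - (\<Sum>\<gamma> | mi_norm \<gamma> \<le> \<theta>. b \<gamma> * monomial \<gamma> (x - c))\<bar>
      \<le> K * norm (x - c) powr (real \<theta> + s))" if c: "c \<in> big_cube a" for c
    by (rule taylor [rule_format, OF c]) (use B c in blast)
  ultimately show ?thesis by blast
qed

end

section \<open>From smoothness in terms of multi-indices to derivatives along sorted lists\<close>

lemma sorted_concat_replicate: "sorted us \<Longrightarrow> sorted (concat (map (\<lambda>j. replicate (n j) j) us))"
  by (induction us) (auto simp: sorted_append sorted_replicate)

lemma count_concat_replicate:
  "distinct us \<Longrightarrow>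
    count (mset (concat (map (\<lambda>j. replicate (n j) j) us))) x = (if x \<in> set us then n x else 0)"
  by (induction us) auto

text \<open>The list generated by the letter counts is sorted and has the same multiset as
  \<open>vs\<close>. So the smoothness hypothesis reaches every sorted list of length
  \<open>\<theta>\<close>.\<close>

lemma sorted_list_of_multi_index:
  fixes vs :: "'n::{finite,linorder} list"
  assumes "sorted vs"
  defines "\<gamma> \<equiv> \<chi> j. count_list vs j"
  shows "concat (map (\<lambda>j. replicate (\<gamma> $ j) j) (sorted_list_of_set UNIV)) = vs"
    and "mi_norm \<gamma> = length vs"
proof -
  let ?us = "concat (map (\<lambda>j. replicate (\<gamma> $ j) j) (sorted_list_of_set UNIV))"
  have "mset ?us = mset vs"
  proof (rule multiset_eqI)
    fix x
    have "count (mset ?us) x = (if x \<in> set (sorted_list_of_set UNIV) then \<gamma> $ x else 0)"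
      by (rule count_concat_replicate) simp
    then show "count (mset ?us) x = count (mset vs) x" by (simp add: \<gamma>_def count_mset)
  qed
  moreover have "sorted ?us" by (rule sorted_concat_replicate) simp
  ultimately have "sort vs = ?us" by (rule properties_for_sort)
  then show "?us = vs" using assms(1) by (simp add: sorted_sort_id)
  show "mi_norm \<gamma> = length vs"
    by (simp add: mi_norm_def \<gamma>_def sum_count_set)
qed

text \<open>The absolute value appears because the sign of \<open>C\<close> is not prescribed, while
  the locale works with a nonnegative constant.\<close>

lemma pC_smooth_ordered_partials:
  assumes "0 < a" "0 < s" "pC_smooth_on \<theta> s C (big_cube a :: (real ^ 'n::{finite,linorder}) set) f"
  shows "ordered_partials a s \<bar>C\<bar> \<theta> (\<lambda>vs. foldr (pd (big_cube a)) vs f)"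
proof
  let ?F = "\<lambda>vs. foldr (pd (big_cube a)) vs f"
  have ex: "\<exists>g. has_iter_partial_on (big_cube a) vs f g \<and>
      (\<forall>x\<in>big_cube a. \<forall>z\<in>big_cube a. \<bar>g x - g z\<bar> \<le> C * norm (x - z) powr s)"
    if "sorted vs" "length vs = \<theta>" for vs :: "'n list"
    using assms(3) sorted_list_of_multi_index [OF that(1)] that(2)
    unfolding pC_smooth_on_def has_mi_partial_on_def by metis
  show "has_partial_on (big_cube a) j (?F vs) (?F (j # vs))"
    if "sorted (j # vs)" "length vs < \<theta>" for j vs
  proof -
    \<comment> \<open>Lower derivatives come from those of order \<open>\<theta>\<close>: copies of
      the head \<open>j\<close> keep the list sorted and raise its length to
      \<open>\<theta>\<close>, and any chain of witnesses for the longer list contains one for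
      \<open>j # vs\<close>.\<close>
    define us where "us = replicate (\<theta> - length (j # vs)) j"
    have "sorted (us @ j # vs)" "length (us @ j # vs) = \<theta>"
      using that by (auto simp: us_def sorted_append sorted_replicate)
    then obtain g where "has_iter_partial_on (big_cube a) (j # vs) f g"
      using ex has_iter_partial_on_append by metis
    then show ?thesis
      by (rule has_iter_partial_on_foldr(2) [OF assms(1) _ refl])
  qed
  show "\<bar>?F vs x - ?F vs z\<bar> \<le> \<bar>C\<bar> * norm (x - z) powr s"
    if vs: "sorted vs" "length vs = \<theta>" and xz: "x \<in> big_cube a" "z \<in> big_cube a" for vs x z
  proof -
    obtain g where g: "has_iter_partial_on (big_cube a) vs f g"
      "\<bar>g x - g z\<bar> \<le> C * norm (x - z) powr s" using ex [OF vs] xz by blast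
    note g(2)
    also have "C * norm (x - z) powr s \<le> \<bar>C\<bar> * norm (x - z) powr s"
      by (intro mult_right_mono) auto
    finally show ?thesis
      using has_iter_partial_on_foldr(1) [OF assms(1) g(1)] xz by simp
  qed
qed (use assms in auto)

section \<open>Approximation by the localized network\<close>

lemma finite_cube_indices: "finite (cube_indices M :: (nat ^ 'n) set)"
proof (rule finite_subset)
  show "cube_indices M \<subseteq> (multi_indices UNIV (CARD('n) * M) :: (nat ^ 'n) set)"
  proof
    fix i :: "nat ^ 'n" assume "i \<in> cube_indices M"
    then have "mi_norm i \<le> (\<Sum>j\<in>(UNIV :: 'n set). M)"
      unfolding mi_norm_def by (intro sum_mono) (simp add: cube_indices_def)
    then show "i \<in> multi_indices UNIV (CARD('n) * M)" by (simp add: multi_indices_UNIV)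
  qed
qed simp

lemma corner_mem_big_cube:
  assumes "0 < a" "i \<in> cube_indices M"
  shows "corner a M i \<in> big_cube a"
proof -
  have "- a + (real (i $ j) - 1) * side a M \<in> {-a..a}" for j
  proof -
    have ij: "1 \<le> i $ j" "i $ j \<le> M" using assms(2) by (auto simp: cube_indices_def)
    then have "(real (i $ j) - 1) * side a M \<le> real M * side a M"
      using assms(1) by (intro mult_right_mono) (auto simp: side_def)
    also have "\<dots> = 2 * a" using ij by (simp add: side_def)
    finally show ?thesis using ij assms(1) by (simp add: side_def)
  qed
  then show ?thesis by (simp add: mem_big_cube corner_def)
qed

lemma local_net_on_cube:
  assumes "cube_partition a M Q" "i \<in> cube_indices M" "x \<in> Q i"
  shows "local_net \<theta> a M m mi Q B (x :: real ^ 'n::{finite,linorder}) =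
    (\<Sum>k=1..num_basis CARD('n) \<theta>. hier_net m (mono_input (x - corner a M i) (mi k)) * B i k)"
proof -
  have "x \<notin> Q i'" if "i' \<in> cube_indices M" "i' \<noteq> i" for i'
    using assms that unfolding cube_partition_def disjoint_family_on_def by blast
  then have "local_net \<theta> a M m mi Q B x =
      (\<Sum>i'\<in>cube_indices M. if i' = i then
        (\<Sum>k=1..num_basis CARD('n) \<theta>. hier_net m (mono_input (x - corner a M i) (mi k)) * B i k) else 0)"
    unfolding local_net_def using assms(3) by (intro sum.cong) (auto simp: indicator_def)
  then show ?thesis
    using assms(2) by (simp add: sum.delta finite_cube_indices)
qed

lemma hier_net_monomial:
  "\<exists>q. \<forall>m (x :: real ^ 'n::{finite,linorder}) \<gamma>. (\<forall>j. x $ j \<in> {0..1}) \<longrightarrow>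
    \<bar>hier_net m (mono_input x \<gamma>) - monomial \<gamma> x\<bar> \<le> 2 ^ q * 2 powi (- int m)"
proof -
  obtain q where q: "\<forall>(x :: real ^ 'n::{finite,linorder}) \<gamma>. length (mono_input x \<gamma>) = 2 ^ q"
    using length_mono_input ..
  have "\<bar>hier_net m (mono_input x \<gamma>) - monomial \<gamma> x\<bar> \<le> 2 ^ q * 2 powi (- int m)"
    if "\<forall>j. x $ j \<in> {0..1}" for m \<gamma> and x :: "real ^ 'n::{finite,linorder}"
  proof -
    have "set (mono_input x \<gamma>) \<subseteq> {0..1}" using that by (auto simp: mono_input_def power_le_one)
    then show ?thesis
      using hier_net_approx [OF _ q [rule_format]]
      by (simp add: prod_list_mono_input monomial_def)
  qed
  then show ?thesis by blast
qed

text \<open>The weights are Taylor coefficients at the corners and do not involve \<open>m\<close>,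
  so \<open>B\<close> can be chosen before \<open>m\<close>. With the supremum in
  \<open>ereal\<close>, the inequality also asserts that it is finite.\<close>

theorem theorem2p1:
  fixes f :: "real ^ 'n::{finite,linorder} \<Rightarrow> real"
    and a p s C :: real
    and \<theta> :: nat
    and mi :: "nat \<Rightarrow> nat ^ 'n::{finite,linorder}"
    and Q :: "nat \<Rightarrow> nat ^ 'n::{finite,linorder} \<Rightarrow> (real ^ 'n::{finite,linorder}) set"
  assumes "a > 0"
    and "\<theta> \<ge> 1" and "0 < s" and "s \<le> 1" and "p = real \<theta> + s"
    and "pC_smooth_on \<theta> s C (big_cube a) f"
    and "bij_betw mi {1..num_basis CARD('n) \<theta>} {\<gamma>. mi_norm \<gamma> \<le> \<theta>}"
    and "\<And>M. M \<ge> 1 \<Longrightarrow> cube_partition a M (Q M)"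
  shows "\<exists>K>0. \<forall>\<^sub>F M in sequentially. \<exists>B :: nat ^ 'n::{finite,linorder} \<Rightarrow> nat \<Rightarrow> real. \<forall>m\<ge>1.
           (SUP x\<in>big_cube a. ereal \<bar>f x - local_net \<theta> a M m mi (Q M) B x\<bar>)
             \<le> ereal (K * (side a M powr p + 2 powi (- int m)))"
proof -
  define r R where "r = real CARD('n)" and "R = num_basis CARD('n) \<theta>"
  interpret ordered_partials a s "\<bar>C\<bar>" \<theta> "\<lambda>vs. foldr (pd (big_cube a)) vs f"
    by (rule pC_smooth_ordered_partials) fact+
  obtain K B0 where K: "0 \<le> K" and B0: "0 \<le> B0"
    and "\<forall>c\<in>big_cube a. \<exists>b. (\<forall>\<gamma>. \<bar>b \<gamma>\<bar> \<le> B0) \<and> (\<forall>x\<in>big_cube a.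
      \<bar>f x - (\<Sum>\<gamma> | mi_norm \<gamma> \<le> \<theta>. b \<gamma> * monomial \<gamma> (x - c))\<bar> \<le> K * norm (x - c) powr p)"
    using uniform_taylor unfolding \<open>p = real \<theta> + s\<close> by auto
  then obtain b where b: "\<And>c \<gamma>. c \<in> big_cube a \<Longrightarrow> \<bar>b c \<gamma>\<bar> \<le> B0"
    and approx: "\<And>c x. c \<in> big_cube a \<Longrightarrow> x \<in> big_cube a \<Longrightarrow>
      \<bar>f x - (\<Sum>\<gamma> | mi_norm \<gamma> \<le> \<theta>. b c \<gamma> * monomial \<gamma> (x - c))\<bar> \<le> K * norm (x - c) powr p"
    unfolding bchoice_iff by blast
  obtain q where q: "\<forall>m (x :: real ^ 'n::{finite,linorder}) \<gamma>. (\<forall>j. x $ j \<in> {0..1}) \<longrightarrow>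
      \<bar>hier_net m (mono_input x \<gamma>) - monomial \<gamma> x\<bar> \<le> 2 ^ q * 2 powi (- int m)"
    using hier_net_monomial ..
  \<comment> \<open>The factor \<open>r powr p\<close> arises from bounding the norm of
    \<open>x - c\<close> by its l1 norm, at most \<open>r\<close> times the side. Each of the
    \<open>R\<close> monomials adds a network error with factor \<open>2 ^ q\<close>, times a
    coefficient of size at most \<open>B0\<close>. The summand 1 ensures positivity.\<close>
  define K' where "K' = 1 + K * r powr p + real R * (2 ^ q * B0)"
  have r: "0 \<le> r" by (simp add: r_def)
  have p: "0 \<le> p" using assms by simp
  have K': "0 < K'" "K * r powr p \<le> K'" "real R * (2 ^ q * B0) \<le> K'"
    using K B0 by (auto simp: K'_def add_pos_nonneg)
  have bound: "\<bar>f x - local_net \<theta> a M m mi (Q M) (\<lambda>i k. b (corner a M i) (mi k)) x\<bar>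
      \<le> K' * (side a M powr p + 2 powi (- int m))"
    if M: "1 \<le> M" "side a M \<le> 1" and x: "x \<in> big_cube a" for M m x
  proof -
    define h where "h = side a M"
    have h: "0 \<le> h" "h \<le> 1" using M assms(1) by (auto simp: h_def side_def)
    have part: "cube_partition a M (Q M)" using assms(8) M by blast
    then obtain i where i: "i \<in> cube_indices M" "x \<in> Q M i"
      using x unfolding cube_partition_def by blast
    define c where "c = corner a M i"
    have c: "c \<in> big_cube a" unfolding c_def by (rule corner_mem_big_cube) fact+
    have "x - c \<in> cbox 0 (\<chi> j. h)" using part i by (auto simp: cube_partition_def c_def h_def)
    then have y: "(x - c) $ j \<in> {0..h}" for j by (simp add: mem_box_cart)
    have "norm (x - c) \<le> (\<Sum>j\<in>UNIV. \<bar>(x - c) $ j\<bar>)" by (rule norm_le_l1_cart)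
    also have "\<dots> \<le> (\<Sum>j\<in>(UNIV :: 'n set). h)"
      by (rule sum_mono) (use y in auto)
    finally have nrm: "norm (x - c) \<le> r * h" by (simp add: r_def)
    have taylor: "\<bar>f x - (\<Sum>k=1..R. monomial (mi k) (x - c) * b c (mi k))\<bar> \<le> K * r powr p * h powr p"
    proof -
      have "(\<Sum>k=1..R. monomial (mi k) (x - c) * b c (mi k)) =
          (\<Sum>\<gamma> | mi_norm \<gamma> \<le> \<theta>. b c \<gamma> * monomial \<gamma> (x - c))"
        unfolding R_def by (subst sum.reindex_bij_betw [OF assms(7), symmetric]) (simp add: mult.commute)
      then have "\<bar>f x - (\<Sum>k=1..R. monomial (mi k) (x - c) * b c (mi k))\<bar> \<le> K * norm (x - c) powr p"
        using approx [OF c x] by simp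
      also have "\<dots> \<le> K * (r * h) powr p"
        using K p nrm by (intro mult_left_mono powr_mono2) auto
      finally show ?thesis using r h by (simp add: powr_mult)
    qed
    have "\<bar>(\<Sum>k=1..R. (monomial (mi k) (x - c) - hier_net m (mono_input (x - c) (mi k))) * b c (mi k))\<bar>
        \<le> (\<Sum>k=1..R. 2 ^ q * 2 powi (- int m) * B0)"
    proof (intro order_trans [OF sum_abs] sum_mono)
      fix k
      have "(x - c) $ j \<in> {0..1}" for j using y [of j] h by auto
      then have "\<bar>hier_net m (mono_input (x - c) (mi k)) - monomial (mi k) (x - c)\<bar> \<le> 2 ^ q * 2 powi (- int m)"
        using q by blast
      then show "\<bar>(monomial (mi k) (x - c) - hier_net m (mono_input (x - c) (mi k))) * b c (mi k)\<bar>
          \<le> 2 ^ q * 2 powi (- int m) * B0"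
        unfolding abs_mult using b [OF c]
        by (intro mult_mono) (auto simp: abs_minus_commute)
    qed
    also have "\<dots> = real R * (2 ^ q * B0) * 2 powi (- int m)" by simp
    finally have net: "\<bar>(\<Sum>k=1..R. monomial (mi k) (x - c) * b c (mi k)) -
        (\<Sum>k=1..R. hier_net m (mono_input (x - c) (mi k)) * b c (mi k))\<bar>
        \<le> real R * (2 ^ q * B0) * 2 powi (- int m)"
      by (simp add: left_diff_distrib sum_subtractf)
    have "local_net \<theta> a M m mi (Q M) (\<lambda>i k. b (corner a M i) (mi k)) x =
        (\<Sum>k=1..R. hier_net m (mono_input (x - c) (mi k)) * b c (mi k))"
      unfolding local_net_on_cube [OF part i] c_def R_def ..
    then have "\<bar>f x - local_net \<theta> a M m mi (Q M) (\<lambda>i k. b (corner a M i) (mi k)) x\<bar>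
        \<le> K * r powr p * h powr p + real R * (2 ^ q * B0) * 2 powi (- int m)"
      using taylor net by linarith
    also have "\<dots> \<le> K' * h powr p + K' * 2 powi (- int m)"
      using K' by (intro add_mono mult_right_mono) auto
    finally show ?thesis by (simp add: h_def distrib_left)
  qed
  show ?thesis
  proof (intro exI [of _ K'] conjI K' eventually_mono [OF eventually_ge_at_top [of "nat \<lceil>2 * a\<rceil> + 1"]])
    \<comment> \<open>The threshold forces side length at most 1, so the offset from the corner has
      coordinates in [0, 1], where the networks are accurate.\<close>
    fix M :: nat assume "nat \<lceil>2 * a\<rceil> + 1 \<le> M"
    then have M: "1 \<le> M" "2 * a \<le> real M" by linarith+
    then have "side a M \<le> 1" by (simp add: side_def)
    then show "\<exists>B. \<forall>m\<ge>1. (SUP x\<in>big_cube a. ereal \<bar>f x - local_net \<theta> a M m mi (Q M) B x\<bar>)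
        \<le> ereal (K' * (side a M powr p + 2 powi (- int m)))"
      using bound M(1)
      by (intro exI [of _ "\<lambda>i k. b (corner a M i) (mi k)"] allI impI SUP_least) simp
  qed
qed

end
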